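(* Under the standing setting, the following statements are equivalent. (i) $X$ a.s. has no negative jumps (i.e. a.s. $X_t-X_{t-}\ge 0$ for all $t\in(0,\zeta)$), and condition (P) holds. (ii) The running infimum process $\underline{X}$ is a.s. continuous (on $[0,\zeta)$), and condition (P) holds. (iii) For each $q\in[0,\infty)$ there exists a nonincreasing map $\Phi_q:I\to(0,\infty)$, which is strictly decreasing and right-continuous if $q>0$, such that $$\mathbb{P}_x[e^{-qT_\ell^-};T_\ell^-<\zeta]=\frac{\Phi_q(x)}{\Phi_q(\ell)}\quad\text{for all }\ell\le x\text{ from }I. \tag{S}$$ (iv) For some $q\in(0,\infty)$ there exists a strictly decreasing map $\Phi_q:I\to(0,\infty)$ such that (S) holds. (v) $X$ is continuous at the minimum and condition (P) holds. Moreover, the statements (i), (ii) and (v) remain equivalent to one another if condition (P) is deleted from each of them.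
   Context: Standing setting: $I\subset\mathbb{R}$ is an interval unbounded above. $X=(X_t)_{t\in[0,\zeta)}$ is a process under complete probability measures $(\mathbb{P}_x)_{x\in I}$ (whose domains all contain $\mathcal{F}_\infty$), adapted to a filtration $\mathcal{F}=(\mathcal{F}_t)_{t\ge0}$ that is complete in the sense that each $\mathcal{F}_t$ contains every set differing from an event of $\mathcal{F}_t$ by a set that is $\mathbb{P}_x$-null for all $x\in I$. The lifetime $\zeta$ is an $\mathcal{F}$-stopping time with $\zeta>0$ a.s., and $X_t:=\infty$ (cemetery) for $t\ge\zeta$. "a.s." means $\mathbb{P}_x$-a.s. for every $x\in I$, and "negligible" means $\mathbb{P}_x$-null for every $x$. Assumptions: paths of $X$ are càdlàg in $I$ on $[0,\zeta)$; on $\{0<\zeta<\infty\}$ the limit $X_{\zeta-}$ exists in $I\cup\{\infty\}$ a.s. (set $X_{\zeta-}:=\infty$ when it does not exist); $x\mapsto\mathbb{P}_x(t<\zeta,X_t\in A)$ is universally measurable for Borel $A\subset I$; normality: $X_0=x$ $\mathbb{P}_x$-a.s.; strong Markov: for every $\mathcal{F}$-stopping time $S$ and measurable $H\ge0$, $\mathbb{P}_x[H(X_{S+\cdot})\mid\mathcal{F}_S]=\mathbb{P}_{X_S}[H(X)]$ $\mathbb{P}_x$-a.s. on $\{S<\zeta\}$; quasi left-continuity: if $\mathcal{F}$-stopping times $T_n$ increase a.s. to $T$ then $X_{T_n}\to X_T$ a.s. on $\{T<\zeta\}$; non-announceability: for every a.s. nondecreasing sequence $(T_n)$ of $\mathcal{F}$-stopping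 times, the event $\{T_n<\zeta\ \forall n\}\cap\{\lim_n T_n=\zeta\}\cap\{\zeta<\infty,X_{\zeta-}<\infty\}$ is negligible. Notation: $\mathbb{P}_x[Y;A]:=\mathbb{E}_x[Y\mathbf{1}_A]$; for $\ell\in I$, $T_\ell^-:=\inf\{t\in[0,\zeta):X_t\le\ell\}$ ($\inf\emptyset=\infty$); $\underline{X}_t:=\inf_{s\in[0,t]}X_s$. Condition (P): $\mathbb{P}_x(T_\ell^-<\zeta)>0$ for all $\ell\le x$ from $I$. Definition: $X$ is continuous at the minimum if $X_{T_a^-}=a$ $\mathbb{P}_x$-a.s. on $\{T_a^-<\zeta\}$ for all $a\le x$ from $I$ with $a>\inf I$. *)

theory Defs
  imports "HOL-Probability.Probability"
begin

text \<open>Time is real (t \<ge> 0); random times take values in [0,\<infinity>] as ereal.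
  States are ereal; the cemetery is \<infinity>.\<close>

definition fstop :: "'a set \<Rightarrow> (real \<Rightarrow> 'a set set) \<Rightarrow> ('a \<Rightarrow> ereal) \<Rightarrow> bool" where
  "fstop \<Omega> F T \<longleftrightarrow> (\<forall>\<omega>\<in>\<Omega>. 0 \<le> T \<omega>) \<and> (\<forall>t\<ge>0. {\<omega>\<in>\<Omega>. T \<omega> \<le> ereal t} \<in> F t)"

definition Finf :: "'a set \<Rightarrow> (real \<Rightarrow> 'a set set) \<Rightarrow> 'a set set" where
  "Finf \<Omega> F = sigma_sets \<Omega> (\<Union>t\<in>{0..}. F t)"

definition pre_stop :: "'a set \<Rightarrow> (real \<Rightarrow> 'a set set) \<Rightarrow> ('a \<Rightarrow> ereal) \<Rightarrow> 'a set set" where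
  "pre_stop \<Omega> F S = {A \<in> Finf \<Omega> F. \<forall>t\<ge>0. A \<inter> {\<omega>\<in>\<Omega>. S \<omega> \<le> ereal t} \<in> F t}"

definition path_meas :: "(real \<Rightarrow> ereal) measure" where
  "path_meas = Pi\<^sub>M {0..} (\<lambda>_. borel)"

definition shift :: "(real \<Rightarrow> 'a \<Rightarrow> ereal) \<Rightarrow> real \<Rightarrow> 'a \<Rightarrow> (real \<Rightarrow> ereal)" where
  "shift X s \<omega> = (\<lambda>t\<in>{0..}. X (s + t) \<omega>)"

text \<open>Value at a random time (used only where that time is finite).\<close>
definition at_time :: "(real \<Rightarrow> 'a \<Rightarrow> ereal) \<Rightarrow> ('a \<Rightarrow> ereal) \<Rightarrow> 'a \<Rightarrow> ereal" where
  "at_time X S \<omega> = X (real_of_ereal (S \<omega>)) \<omega>"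

definition left_lim :: "(real \<Rightarrow> 'a \<Rightarrow> ereal) \<Rightarrow> real \<Rightarrow> 'a \<Rightarrow> ereal" where
  "left_lim X t \<omega> = Lim (at_left t) (\<lambda>s. X s \<omega>)"

definition zeta_minus :: "real set \<Rightarrow> (real \<Rightarrow> 'a \<Rightarrow> ereal) \<Rightarrow> ('a \<Rightarrow> ereal) \<Rightarrow> 'a \<Rightarrow> ereal" where
  "zeta_minus I X \<zeta> \<omega> =
     (if 0 < \<zeta> \<omega> \<and> \<zeta> \<omega> < \<infinity> \<and>
         (\<exists>l. (l \<in> ereal ` I \<or> l = \<infinity>) \<and> ((\<lambda>s. X s \<omega>) \<longlongrightarrow> l) (at_left (real_of_ereal (\<zeta> \<omega>))))
      then Lim (at_left (real_of_ereal (\<zeta> \<omega>))) (\<lambda>s. X s \<omega>) else \<infinity>)"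

definition Tminus :: "(real \<Rightarrow> 'a \<Rightarrow> ereal) \<Rightarrow> ('a \<Rightarrow> ereal) \<Rightarrow> real \<Rightarrow> 'a \<Rightarrow> ereal" where
  "Tminus X \<zeta> l \<omega> = Inf {ereal t | t. 0 \<le> t \<and> ereal t < \<zeta> \<omega> \<and> X t \<omega> \<le> ereal l}"

definition run_inf :: "(real \<Rightarrow> 'a \<Rightarrow> ereal) \<Rightarrow> real \<Rightarrow> 'a \<Rightarrow> ereal" where
  "run_inf X t \<omega> = (INF s\<in>{0..t}. X s \<omega>)"

definition univ_measurable :: "real set \<Rightarrow> (real \<Rightarrow> real) \<Rightarrow> bool" where
  "univ_measurable I f \<longleftrightarrow>
     (\<forall>\<mu>. sets \<mu> = sets (restrict_space borel I) \<longrightarrow> finite_measure \<mu> \<longrightarrow>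
          f \<in> borel_measurable (completion \<mu>))"

definition standing_setting ::
  "real set \<Rightarrow> 'a set \<Rightarrow> (real \<Rightarrow> 'a set set) \<Rightarrow> (real \<Rightarrow> 'a measure)
     \<Rightarrow> (real \<Rightarrow> 'a \<Rightarrow> ereal) \<Rightarrow> ('a \<Rightarrow> ereal) \<Rightarrow> bool" where
  "standing_setting I \<Omega> F P X \<zeta> \<longleftrightarrow>
    \<comment> \<open>I: interval unbounded above\<close>
    is_interval I \<and> I \<noteq> {} \<and> (\<forall>b. \<exists>x\<in>I. b < x) \<and>
    \<comment> \<open>filtration\<close>
    (\<forall>t\<ge>0. sigma_algebra \<Omega> (F t)) \<and> (\<forall>s t. 0 \<le> s \<longrightarrow> s \<le> t \<longrightarrow> F s \<subseteq> F t) \<and>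
    \<comment> \<open>complete probability measures whose domains contain F_\<infinity>\<close>
    (\<forall>x\<in>I. prob_space (P x) \<and> complete_measure (P x) \<and> space (P x) = \<Omega> \<and>
       Finf \<Omega> F \<subseteq> sets (P x)) \<and>
    \<comment> \<open>completeness of the filtration\<close>
    (\<forall>t\<ge>0. \<forall>A B. A \<subseteq> \<Omega> \<longrightarrow> B \<in> F t \<longrightarrow>
       (\<forall>x\<in>I. (A - B) \<union> (B - A) \<in> null_sets (P x)) \<longrightarrow> A \<in> F t) \<and>
    \<comment> \<open>adaptedness\<close>
    (\<forall>t\<ge>0. \<forall>B\<in>sets (borel :: ereal measure). {\<omega>\<in>\<Omega>. X t \<omega> \<in> B} \<in> F t) \<and>
    \<comment> \<open>lifetime: stopping time, positive a.s., cemetery after \<zeta>\<close>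
    fstop \<Omega> F \<zeta> \<and> (\<forall>x\<in>I. AE \<omega> in P x. 0 < \<zeta> \<omega>) \<and>
    (\<forall>\<omega>\<in>\<Omega>. \<forall>t\<ge>0. \<zeta> \<omega> \<le> ereal t \<longrightarrow> X t \<omega> = \<infinity>) \<and>
    \<comment> \<open>paths cadlag in I on [0,\<zeta>)\<close>
    (\<forall>\<omega>\<in>\<Omega>. \<forall>t. 0 \<le> t \<and> ereal t < \<zeta> \<omega> \<longrightarrow>
       X t \<omega> \<in> ereal ` I \<and> ((\<lambda>s. X s \<omega>) \<longlongrightarrow> X t \<omega>) (at_right t) \<and>
       (0 < t \<longrightarrow> (\<exists>l\<in>I. ((\<lambda>s. X s \<omega>) \<longlongrightarrow> ereal l) (at_left t)))) \<and>
    \<comment> \<open>X_{\<zeta>-} exists in I \<union> {\<infinity>} a.s. on {0<\<zeta><\<infinity>}\<close>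
    (\<forall>x\<in>I. AE \<omega> in P x. 0 < \<zeta> \<omega> \<and> \<zeta> \<omega> < \<infinity> \<longrightarrow>
       (\<exists>l. (l \<in> ereal ` I \<or> l = \<infinity>) \<and>
            ((\<lambda>s. X s \<omega>) \<longlongrightarrow> l) (at_left (real_of_ereal (\<zeta> \<omega>))))) \<and>
    \<comment> \<open>universal measurability of the transition probabilities\<close>
    (\<forall>t\<ge>0. \<forall>A\<in>sets (borel :: real measure). A \<subseteq> I \<longrightarrow>
       univ_measurable I (\<lambda>x. measure (P x) {\<omega>\<in>\<Omega>. ereal t < \<zeta> \<omega> \<and> X t \<omega> \<in> ereal ` A})) \<and>
    \<comment> \<open>normality\<close>
    (\<forall>x\<in>I. AE \<omega> in P x. X 0 \<omega> = ereal x) \<and>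
    \<comment> \<open>strong Markov property (defining identity of the conditional expectation)\<close>
    (\<forall>S H A x. fstop \<Omega> F S \<longrightarrow> H \<in> borel_measurable path_meas \<longrightarrow>
       A \<in> pre_stop \<Omega> F S \<longrightarrow> x \<in> I \<longrightarrow>
       (\<integral>\<^sup>+\<omega>. H (shift X (real_of_ereal (S \<omega>)) \<omega>) * indicator (A \<inter> {\<omega>. S \<omega> < \<zeta> \<omega>}) \<omega> \<partial>P x)
       = (\<integral>\<^sup>+\<omega>. (\<integral>\<^sup>+\<omega>'. H (shift X 0 \<omega>') \<partial>P (real_of_ereal (at_time X S \<omega>)))
                 * indicator (A \<inter> {\<omega>. S \<omega> < \<zeta> \<omega>}) \<omega> \<partial>P x)) \<and>
    \<comment> \<open>quasi left-continuity\<close>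
    (\<forall>Tn T. (\<forall>n. fstop \<Omega> F (Tn n)) \<longrightarrow> fstop \<Omega> F T \<longrightarrow>
       (\<forall>x\<in>I. AE \<omega> in P x. incseq (\<lambda>n. Tn n \<omega>) \<and> (\<lambda>n. Tn n \<omega>) \<longlonglongrightarrow> T \<omega>) \<longrightarrow>
       (\<forall>x\<in>I. AE \<omega> in P x. T \<omega> < \<zeta> \<omega> \<longrightarrow>
          (\<lambda>n. at_time X (Tn n) \<omega>) \<longlonglongrightarrow> at_time X T \<omega>)) \<and>
    \<comment> \<open>non-announceability of \<zeta> on {\<zeta><\<infinity>, X_{\<zeta>-}<\<infinity>}\<close>
    (\<forall>Tn. (\<forall>n. fstop \<Omega> F (Tn n)) \<longrightarrow>
       (\<forall>x\<in>I. AE \<omega> in P x. incseq (\<lambda>n. Tn n \<omega>)) \<longrightarrow>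
       (\<forall>x\<in>I. AE \<omega> in P x. \<not> ((\<forall>n. Tn n \<omega> < \<zeta> \<omega>) \<and> (\<lambda>n. Tn n \<omega>) \<longlonglongrightarrow> \<zeta> \<omega> \<and>
                                   \<zeta> \<omega> < \<infinity> \<and> zeta_minus I X \<zeta> \<omega> < \<infinity>)))"

definition condP :: "real set \<Rightarrow> 'a set \<Rightarrow> (real \<Rightarrow> 'a measure)
     \<Rightarrow> (real \<Rightarrow> 'a \<Rightarrow> ereal) \<Rightarrow> ('a \<Rightarrow> ereal) \<Rightarrow> bool" where
  "condP I \<Omega> P X \<zeta> \<longleftrightarrow>
    (\<forall>x\<in>I. \<forall>l\<in>I. l \<le> x \<longrightarrow> 0 < emeasure (P x) {\<omega>\<in>\<Omega>. Tminus X \<zeta> l \<omega> < \<zeta> \<omega>})"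

definition no_neg_jumps :: "real set \<Rightarrow> (real \<Rightarrow> 'a measure)
     \<Rightarrow> (real \<Rightarrow> 'a \<Rightarrow> ereal) \<Rightarrow> ('a \<Rightarrow> ereal) \<Rightarrow> bool" where
  "no_neg_jumps I P X \<zeta> \<longleftrightarrow>
    (\<forall>x\<in>I. AE \<omega> in P x. \<forall>t. 0 < t \<and> ereal t < \<zeta> \<omega> \<longrightarrow> left_lim X t \<omega> \<le> X t \<omega>)"

definition run_inf_continuous :: "real set \<Rightarrow> (real \<Rightarrow> 'a measure)
     \<Rightarrow> (real \<Rightarrow> 'a \<Rightarrow> ereal) \<Rightarrow> ('a \<Rightarrow> ereal) \<Rightarrow> bool" where
  "run_inf_continuous I P X \<zeta> \<longleftrightarrow>
    (\<forall>x\<in>I. AE \<omega> in P x. continuous_on {t. 0 \<le> t \<and> ereal t < \<zeta> \<omega>} (\<lambda>t. run_inf X t \<omega>))"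

definition cont_at_min :: "real set \<Rightarrow> (real \<Rightarrow> 'a measure)
     \<Rightarrow> (real \<Rightarrow> 'a \<Rightarrow> ereal) \<Rightarrow> ('a \<Rightarrow> ereal) \<Rightarrow> bool" where
  "cont_at_min I P X \<zeta> \<longleftrightarrow>
    (\<forall>x\<in>I. \<forall>a\<in>I. a \<le> x \<and> (\<exists>b\<in>I. b < a) \<longrightarrow>
       (AE \<omega> in P x. Tminus X \<zeta> a \<omega> < \<zeta> \<omega> \<longrightarrow> at_time X (Tminus X \<zeta> a) \<omega> = ereal a))"

definition laplace_id :: "real set \<Rightarrow> (real \<Rightarrow> 'a measure)
     \<Rightarrow> (real \<Rightarrow> 'a \<Rightarrow> ereal) \<Rightarrow> ('a \<Rightarrow> ereal) \<Rightarrow> real \<Rightarrow> (real \<Rightarrow> real) \<Rightarrow> bool" where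
  "laplace_id I P X \<zeta> q \<Phi> \<longleftrightarrow>
    (\<forall>x\<in>I. \<forall>l\<in>I. l \<le> x \<longrightarrow>
       (\<integral>\<^sup>+\<omega>. ennreal (exp (- q * real_of_ereal (Tminus X \<zeta> l \<omega>)))
              * indicator {\<omega>. Tminus X \<zeta> l \<omega> < \<zeta> \<omega>} \<omega> \<partial>P x)
       = ennreal (\<Phi> x / \<Phi> l))"

end

theory Submission
  imports Defs
begin

text \<open>
  The first time \<open>tau l\<close> at which the running infimum is at most \<open>l\<close> is a stopping time, even though
  the filtration need not be right-continuous, and quasi left-continuity together with
  non-announceability of the lifetime shows that it almost surely equals \<open>Tminus X \<zeta> l\<close>.

  Absence of negative jumps makes the running infimum continuous, and continuity of the running
  infimum forces \<open>X\<close> to sit at \<open>a\<close> when it first reaches \<open>{..a}\<close>; both implications are pathwise.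
  Conversely, after some rational time a negative jump looks like a first passage below \<open>a\<close> that is at
  the same time a first passage below some rational \<open>b < a\<close>, and the Markov property at rational
  times shows that this has probability zero if \<open>X\<close> is continuous at the minimum.

  If \<open>X\<close> is continuous at the minimum, the strong Markov property at \<open>tau m\<close> makes
  \<open>K q x l = P\<^sub>x[exp (- q * tau l); tau l < \<zeta>]\<close> multiplicative, \<open>K q x l = K q x m * K q m l\<close>,
  which yields \<open>\<Phi>\<close>; its right-continuity comes from \<open>tau (l + 1 / n)\<close> increasing to \<open>tau l\<close>.
  Conversely, given \<open>\<Phi>\<close>, the strong Markov property at \<open>tau a\<close> gives
  \<open>\<Phi> x / \<Phi> b \<ge> \<Phi> x / \<Phi> b + (1 - \<Phi> a / \<Phi> b) * P\<^sub>x[exp (- q * tau a); tau a = tau b < \<zeta>]\<close>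
  for \<open>b < a\<close>, so that overshooting below \<open>b\<close> is impossible.
\<close>

section \<open>Right-continuous paths\<close>

text \<open>The cemetery \<open>\<infinity>\<close> counts as an ordinary value, so right-continuity
  can be asked at every time, past the lifetime included.\<close>

definition rc :: "(real \<Rightarrow> ereal) \<Rightarrow> bool" where
  "rc w \<longleftrightarrow> (\<forall>t\<ge>0. (w \<longlongrightarrow> w t) (at_right t))"

definition rinf :: "(real \<Rightarrow> ereal) \<Rightarrow> real \<Rightarrow> ereal" where
  "rinf w t = (INF s\<in>{0..t}. w s)"

text \<open>Going through \<open>rinf\<close> registers a passage also when the path merely
  approaches \<open>l\<close> from above by a left limit and then jumps away.\<close>

definition hit :: "(real \<Rightarrow> ereal) \<Rightarrow> real \<Rightarrow> ereal" where
  "hit w l = Inf {ereal t | t. 0 \<le> t \<and> rinf w t \<le> ereal l}"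

text \<open>Versions of running infimum, passage time and lifetime that look at countably many times only.
  They are measurable for the product algebra on paths, unlike \<open>rinf\<close> and \<open>hit\<close>, with which they
  agree on right-continuous paths.\<close>

definition qinf :: "(real \<Rightarrow> ereal) \<Rightarrow> real \<Rightarrow> ereal" where
  "qinf w t = min (INF s\<in>\<rat> \<inter> {0..t}. w s) (w t)"

definition qhit :: "(real \<Rightarrow> ereal) \<Rightarrow> real \<Rightarrow> ereal" where
  "qhit w l = (INF s\<in>\<rat> \<inter> {0..}. if qinf w s \<le> ereal l then ereal s else \<infinity>)"

definition qlife :: "(real \<Rightarrow> ereal) \<Rightarrow> ereal" where
  "qlife w = (INF s\<in>\<rat> \<inter> {0..}. if w s = \<infinity> then ereal s else \<infinity>)"

lemma rcD: "rc w \<Longrightarrow> 0 \<le> t \<Longrightarrow> (w \<longlongrightarrow> w t) (at_right t)"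
  by (simp add: rc_def)

lemma rc_gt_nbhd:
  assumes "rc w" "0 \<le> t" "c < w t"
  obtains e where "e > 0" "\<And>s. t \<le> s \<Longrightarrow> s < t + e \<Longrightarrow> c < w s"
proof -
  have "eventually (\<lambda>s. c < w s) (at_right t)"
    using order_tendstoD(1)[OF rcD[OF assms(1,2)] assms(3)] .
  then obtain b where b: "b > t" "\<And>y. t < y \<Longrightarrow> y < b \<Longrightarrow> c < w y"
    unfolding eventually_at_right_field by blast
  show thesis
    by (rule that[of "b - t"]) (use b assms(3) in \<open>auto simp: less_eq_real_def\<close>)
qed

lemma rc_lt_nbhd:
  assumes "rc w" "0 \<le> t" "w t < c"
  obtains e where "e > 0" "\<And>s. t \<le> s \<Longrightarrow> s < t + e \<Longrightarrow> w s < c"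
proof -
  have "eventually (\<lambda>s. w s < c) (at_right t)"
    using order_tendstoD(2)[OF rcD[OF assms(1,2)] assms(3)] .
  then obtain b where b: "b > t" "\<And>y. t < y \<Longrightarrow> y < b \<Longrightarrow> w y < c"
    unfolding eventually_at_right_field by blast
  show thesis
    by (rule that[of "b - t"]) (use b assms(3) in \<open>auto simp: less_eq_real_def\<close>)
qed

lemma rc_shift:
  assumes "rc w" "0 \<le> s"
  shows "rc (\<lambda>t. w (s + t))"
  unfolding rc_def
proof (intro allI impI)
  fix t :: real assume t: "0 \<le> t"
  have "(w \<longlongrightarrow> w (s + t)) (at_right (s + t))"
    using rcD[OF assms(1)] t assms(2) by simp
  then have "((\<lambda>u. w (u + s)) \<longlongrightarrow> w (s + t)) (at_right t)"
    by (simp add: filterlim_shift_iff at_right_to_0[of "s + t"] at_right_to_0[of t] filterlim_filtermap add_ac)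
  then show "((\<lambda>u. w (s + u)) \<longlongrightarrow> w (s + t)) (at_right t)"
    by (simp add: add.commute)
qed

lemma rc_cong:
  assumes "rc w" "\<And>t. 0 \<le> t \<Longrightarrow> w t = v t"
  shows "rc v"
  unfolding rc_def
proof (intro allI impI)
  fix t :: real assume t: "0 \<le> t"
  have "eventually (\<lambda>u. w u = v u) (at_right t)"
    unfolding eventually_at_right_field using assms(2) t by (intro exI[of _ "t + 1"]) auto
  with rcD[OF assms(1) t] show "(v \<longlongrightarrow> v t) (at_right t)"
    using assms(2)[OF t] by (simp add: tendsto_cong)
qed

section \<open>Running infimum and first passage of a single path\<close>

lemma rinf_le: "0 \<le> s \<Longrightarrow> s \<le> t \<Longrightarrow> rinf w t \<le> w s"
  unfolding rinf_def by (rule INF_lower) auto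

lemma rinf_antimono: "s \<le> t \<Longrightarrow> rinf w t \<le> rinf w s"
  unfolding rinf_def by (rule INF_superset_mono) auto

lemma rinf_ge: "(\<And>s. 0 \<le> s \<Longrightarrow> s \<le> t \<Longrightarrow> c \<le> w s) \<Longrightarrow> c \<le> rinf w t"
  unfolding rinf_def by (rule INF_greatest) auto

lemma rinf_lessD: "rinf w t < c \<Longrightarrow> \<exists>s. 0 \<le> s \<and> s \<le> t \<and> w s < c"
  unfolding rinf_def INF_less_iff by auto

lemma rinf_gt_nbhd:
  assumes "rc w" "0 \<le> t" "c < rinf w t"
  obtains e where "e > 0" "c < rinf w (t + e)"
proof -
  \<comment> \<open>An infimum of values above \<open>c\<close> is only known to be at least
    \<open>c\<close>; the intermediate level restores the strict inequality.\<close>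
  obtain d where d: "c < d" "d < rinf w t" using dense[OF assms(3)] by blast
  have "d < w t" using d(2) rinf_le[of t t w] assms(2) by (meson less_le_trans order_refl)
  then obtain e where e: "e > 0" "\<And>s. t \<le> s \<Longrightarrow> s < t + e \<Longrightarrow> d < w s"
    using rc_gt_nbhd[OF assms(1,2)] by blast
  have "d \<le> rinf w (t + e/2)"
  proof (rule rinf_ge)
    fix s assume s: "0 \<le> s" "s \<le> t + e/2"
    show "d \<le> w s"
    proof (cases "s \<le> t")
      case True
      then show ?thesis using rinf_le[of s t w] s d(2) by (meson less_le_trans less_imp_le)
    next
      case False
      then show ?thesis using e s by (intro less_imp_le e(2)) auto
    qed
  qed
  then show thesis using e(1) d(1) that[of "e/2"] by force
qed

lemma hit_nonneg: "0 \<le> hit w l"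
  unfolding hit_def by (rule Inf_greatest) auto

text \<open>The infimum in \<open>hit\<close> is attained: if \<open>rinf\<close> still exceeds
  \<open>l\<close> at \<open>t\<close>, right-continuity keeps it above \<open>l\<close> a little
  longer. Whether passage has occurred by time \<open>t\<close> is thus decided by the path on
  \<open>[0,t]\<close>.\<close>

lemma hit_le_iff:
  assumes "rc w" "0 \<le> t"
  shows "hit w l \<le> ereal t \<longleftrightarrow> rinf w t \<le> ereal l"
proof
  assume "rinf w t \<le> ereal l"
  then show "hit w l \<le> ereal t"
    unfolding hit_def using assms(2) by (intro Inf_lower) auto
next
  assume h: "hit w l \<le> ereal t"
  show "rinf w t \<le> ereal l"
  proof (rule ccontr)
    assume "\<not> ?thesis"
    then obtain e where e: "e > 0" "ereal l < rinf w (t + e)"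
      using rinf_gt_nbhd[OF assms] by (metis not_le)
    have "ereal (t + e) \<le> hit w l"
      unfolding hit_def
    proof (rule Inf_greatest, clarify)
      fix s assume s: "0 \<le> s" "rinf w s \<le> ereal l"
      show "ereal (t + e) \<le> ereal s"
      proof (rule ccontr)
        assume "\<not> ?thesis"
        then have "rinf w (t + e) \<le> rinf w s" by (intro rinf_antimono) auto
        with s e show False by auto
      qed
    qed
    with h have "ereal (t + e) \<le> ereal t" by (rule order_trans[rotated])
    with e(1) show False by simp
  qed
qed

lemma hit_antimono: "a \<le> b \<Longrightarrow> hit w b \<le> hit w a"
  unfolding hit_def
  by (rule Inf_superset_mono) (use ereal_less_eq(3) order_trans in blast)

lemma hit_le_of_value:
  assumes "0 \<le> t" "w t \<le> ereal l"
  shows "hit w l \<le> ereal t"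
  unfolding hit_def
  using assms rinf_le[of t t w] by (intro Inf_lower) (auto intro: order_trans)

lemma before_hit:
  assumes "0 \<le> s" "ereal s < hit w l"
  shows "ereal l < w s"
  using hit_le_of_value[of s w l] assms by (meson not_le)

lemma before_hit_rinf:
  assumes "0 \<le> s" "ereal s < hit w l"
  shows "ereal l < rinf w s"
proof (rule ccontr)
  assume "\<not> ?thesis"
  then have "hit w l \<le> ereal s" unfolding hit_def using assms(1) by (intro Inf_lower) auto
  with assms show False by simp
qed

text \<open>Before \<open>t\<close> the path stays above \<open>a\<close>, so only the value at
  \<open>t\<close> itself can bring the infimum down to \<open>b\<close>. Coinciding passage times
  therefore mean an overshoot.\<close>

lemma hit_eq_value_le:
  assumes "rc w" "b < a" "hit w a = ereal t" "hit w b = ereal t"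
  shows "w t \<le> ereal b"
proof (rule ccontr)
  assume c: "\<not> ?thesis"
  have t: "0 \<le> t" using hit_nonneg[of w a] assms(3) by simp
  have "min (ereal a) (w t) \<le> rinf w t"
  proof (rule rinf_ge)
    fix s assume s: "0 \<le> s" "s \<le> t"
    show "min (ereal a) (w t) \<le> w s"
    proof (cases "s = t")
      case False
      then have "ereal a < w s" using s assms(3) by (simp add: before_hit)
      then show ?thesis by (auto simp: min_def)
    qed auto
  qed
  moreover have "rinf w t \<le> ereal b" using hit_le_iff[OF assms(1) t, of b] assms(4) by simp
  moreover have "ereal b < min (ereal a) (w t)" using c assms(2) by (auto simp: min_def)
  ultimately show False by (meson leD less_le_trans)
qed

text \<open>At the supremum of these times the running infimum is at most every
  \<open>l + 1 / real (Suc n)\<close>, hence at most \<open>l\<close>. This provides the sequence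
  that announces the passage at \<open>l\<close>.\<close>

lemma hit_tendsto:
  assumes "rc w"
  shows "incseq (\<lambda>n. hit w (l + 1 / real (Suc n)))"
    and "(\<lambda>n. hit w (l + 1 / real (Suc n))) \<longlonglongrightarrow> hit w l"
proof -
  show inc: "incseq (\<lambda>n. hit w (l + 1 / real (Suc n)))"
    by (intro incseq_SucI hit_antimono) (auto simp: field_simps)
  let ?s = "SUP n. hit w (l + 1 / real (Suc n))"
  have le: "?s \<le> hit w l" by (intro SUP_least hit_antimono) auto
  have ge: "hit w l \<le> ?s"
  proof (cases ?s)
    case (real r)
    have r: "0 \<le> r" using real hit_nonneg[of w "l + 1"] SUP_upper[of 0 UNIV "\<lambda>n. hit w (l + 1 / real (Suc n))"]
      by (metis (no_types, lifting) UNIV_I ereal_less_eq(5) hit_nonneg order_trans)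
    have "rinf w r \<le> ereal (l + 1 / real (Suc n))" for n
    proof -
      have "hit w (l + 1 / real (Suc n)) \<le> ereal r"
        using SUP_upper[of n UNIV "\<lambda>n. hit w (l + 1 / real (Suc n))"] real by simp
      then show ?thesis using hit_le_iff[OF assms r] by blast
    qed
    moreover have "(\<lambda>n. ereal (l + 1 / real (Suc n))) \<longlonglongrightarrow> ereal (l + 0)"
      unfolding lim_ereal by (intro tendsto_add tendsto_const LIMSEQ_Suc lim_1_over_n)
    ultimately have "rinf w r \<le> ereal l"
      using LIMSEQ_le_const[of "\<lambda>n. ereal (l + 1 / real (Suc n))" "ereal l"] by simp
    then show ?thesis using hit_le_iff[OF assms r] real by simp
  next
    case MInf
    then show ?thesis
      using SUP_upper[of 0 UNIV "\<lambda>n. hit w (l + 1 / real (Suc n))"] hit_nonneg[of w "l+1"] by simp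
  qed simp
  show "(\<lambda>n. hit w (l + 1 / real (Suc n))) \<longlonglongrightarrow> hit w l"
    using LIMSEQ_SUP[OF inc] le ge by (simp add: antisym)
qed

lemma hit_cong: "(\<And>t. 0 \<le> t \<Longrightarrow> w t = v t) \<Longrightarrow> hit w l = hit v l"
proof -
  assume *: "\<And>t. 0 \<le> t \<Longrightarrow> w t = v t"
  then have "rinf w t = rinf v t" for t unfolding rinf_def by (intro INF_cong) auto
  then show ?thesis by (simp add: hit_def)
qed

text \<open>Up to the passage at \<open>a\<close> the path stays above \<open>a > b\<close>, so that
  stretch contributes nothing to the passage at \<open>b\<close>.\<close>

lemma hit_split:
  assumes "rc w" "b < a" "hit w a = ereal s"
  shows "hit w b = ereal s + hit (\<lambda>t. w (s + t)) b"
proof -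
  let ?v = "\<lambda>t. w (s + t)"
  have s: "0 \<le> s" using hit_nonneg[of w a] assms(3) by simp
  have rv: "rc ?v" using rc_shift[OF assms(1) s] .
  \<comment> \<open>Two times in \<open>[0,\<infinity>]\<close> are compared through the
    deterministic times that bound them, where \<open>hit_le_iff\<close> reduces everything to
    running infima.\<close>
  have eq: "hit w b \<le> ereal (s + t) \<longleftrightarrow> hit ?v b \<le> ereal t" if t: "0 \<le> t" for t
  proof -
    have "rinf w (s + t) \<le> ereal b \<longleftrightarrow> rinf ?v t \<le> ereal b"
    proof
      assume "rinf ?v t \<le> ereal b"
      moreover have "rinf w (s + t) \<le> rinf ?v t"
        by (rule rinf_ge) (use s in \<open>auto intro: rinf_le\<close>)
      ultimately show "rinf w (s + t) \<le> ereal b" by (rule order_trans[rotated])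
    next
      assume le: "rinf w (s + t) \<le> ereal b"
      have "min (ereal a) (rinf ?v t) \<le> rinf w (s + t)"
      proof (rule rinf_ge)
        fix u assume u: "0 \<le> u" "u \<le> s + t"
        show "min (ereal a) (rinf ?v t) \<le> w u"
        proof (cases "u < s")
          case True
          then have "ereal a < w u" using u assms(3) by (simp add: before_hit)
          then show ?thesis by (auto simp: min_def)
        next
          case False
          then have "rinf ?v t \<le> ?v (u - s)" using u by (intro rinf_le) auto
          then show ?thesis by (auto simp: min_def)
        qed
      qed
      with le have "min (ereal a) (rinf ?v t) \<le> ereal b" by (rule order_trans[rotated])
      then show "rinf ?v t \<le> ereal b" using assms(2) by (auto simp: min_le_iff_disj)
    qed
    then show ?thesis using hit_le_iff[OF assms(1)] hit_le_iff[OF rv t] s t by auto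
  qed
  have ge: "ereal s \<le> hit w b" using hit_antimono[of b a w] assms by simp
  show ?thesis
  proof (rule antisym)
    show "hit w b \<le> ereal s + hit ?v b"
    proof (cases "hit ?v b")
      case (real r)
      then show ?thesis using eq[of r] hit_nonneg[of ?v b] by simp
    qed (use hit_nonneg[of ?v b] in auto)
    show "ereal s + hit ?v b \<le> hit w b"
    proof (cases "hit w b")
      case (real r)
      then have "hit ?v b \<le> ereal (r - s)" using eq[of "r - s"] ge by simp
      then have "ereal s + hit ?v b \<le> ereal s + ereal (r - s)" by (rule add_left_mono)
      then show ?thesis using real by simp
    qed (use ge in auto)
  qed
qed

text \<open>Right-continuity moves a small value at \<open>s < t\<close> to a rational time slightly
  later but still before \<open>t\<close>. At the endpoint this would leave \<open>[0,t]\<close>,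
  which is why \<open>qinf\<close> carries the separate term \<open>w t\<close>.\<close>

lemma qinf_eq_rinf:
  assumes "rc w" "0 \<le> t"
  shows "qinf w t = rinf w t"
proof (rule antisym)
  show "rinf w t \<le> qinf w t"
    unfolding qinf_def
    by (rule min.boundedI, rule INF_greatest) (use assms in \<open>auto intro: rinf_le\<close>)
  show "qinf w t \<le> rinf w t"
  proof (rule rinf_ge, rule ccontr)
    fix s assume s: "0 \<le> s" "s \<le> t" and "\<not> qinf w t \<le> w s"
    then have lt: "w s < qinf w t" by simp
    have "s \<noteq> t" using lt unfolding qinf_def by auto
    obtain e where e: "e > 0" "\<And>u. s \<le> u \<Longrightarrow> u < s + e \<Longrightarrow> w u < qinf w t"
      using rc_lt_nbhd[OF assms(1) s(1) lt] by blast
    obtain r where r: "r \<in> \<rat>" "s < r" "r < min (s + e) t"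
      using Rats_dense_in_real[of s "min (s + e) t"] e(1) s \<open>s \<noteq> t\<close> by auto
    then have "qinf w t \<le> w r"
      unfolding qinf_def using s by (intro min.coboundedI1 INF_lower) auto
    moreover have "w r < qinf w t" using e(2)[of r] r by auto
    ultimately show False by simp
  qed
qed

text \<open>Since \<open>rinf\<close> is antitone, the times with \<open>rinf\<close> at most
  \<open>l\<close> are upward closed, so rational times just above \<open>hit w l\<close> recover
  the infimum.\<close>

lemma qhit_eq_hit:
  assumes "rc w"
  shows "qhit w l = hit w l"
proof (rule antisym)
  show "hit w l \<le> qhit w l"
    unfolding qhit_def
    by (rule INF_greatest) (use hit_le_iff[OF assms] qinf_eq_rinf[OF assms] in auto)
  show "qhit w l \<le> hit w l"
  proof (rule dense_ge)
    fix y assume y: "hit w l < y"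
    then obtain r where r: "hit w l < ereal r" "ereal r < y" using ereal_dense2 by blast
    \<comment> \<open>A real bound in place of the extended value \<open>hit w l\<close>, so that
      density of the rationals in the reals applies.\<close>
    obtain p where p: "p < r" "hit w l \<le> ereal p" 
      using r(1) hit_nonneg[of w l] by (cases "hit w l") auto
    obtain q where q: "q \<in> \<rat>" "p < q" "q < r" using Rats_dense_in_real[OF p(1)] by blast
    have "0 \<le> p" using p hit_nonneg[of w l] by (metis ereal_less_eq(5) order_trans)
    then have q0: "0 \<le> q" using q by simp
    have "hit w l \<le> ereal q" using p(2) q(2) by (meson ereal_less_eq(3) less_imp_le order_trans)
    then have "qinf w q \<le> ereal l" using hit_le_iff[OF assms q0] qinf_eq_rinf[OF assms q0] by simp
    then have "qhit w l \<le> ereal q"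
      unfolding qhit_def using q q0 by (intro INF_lower2[of q]) auto
    then show "qhit w l \<le> y" using q(3) r(2) by (meson ereal_less_eq(3) less_imp_le order_trans)
  qed
qed

text \<open>The path is infinite exactly from \<open>z\<close> on, so rational times just above
  \<open>z\<close> detect it.\<close>

lemma qlife_eq:
  assumes z: "\<And>t. 0 \<le> t \<Longrightarrow> w t = \<infinity> \<longleftrightarrow> z \<le> ereal t" and "0 \<le> z"
  shows "qlife w = z"
proof (rule antisym)
  show "z \<le> qlife w"
    unfolding qlife_def by (rule INF_greatest) (use z in auto)
  show "qlife w \<le> z"
  proof (rule dense_ge)
    fix y assume y: "z < y"
    then obtain r where r: "z < ereal r" "ereal r < y" using ereal_dense2 by blast
    obtain p where p: "p < r" "z \<le> ereal p" using r(1) assms(2) by (cases z) auto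
    obtain q where q: "q \<in> \<rat>" "p < q" "q < r" using Rats_dense_in_real[OF p(1)] by blast
    have "0 \<le> p" using p assms(2) by (metis ereal_less_eq(5) order_trans)
    then have q0: "0 \<le> q" using q by simp
    have "z \<le> ereal q" using p(2) q(2) by (meson ereal_less_eq(3) less_imp_le order_trans)
    then have "qlife w \<le> ereal q"
      unfolding qlife_def using q q0 z[OF q0] by (intro INF_lower2[of q]) auto
    then show "qlife w \<le> y" using q(3) r(2) by (meson ereal_less_eq(3) less_imp_le order_trans)
  qed
qed

text \<open>Near \<open>t\<close> the left limit keeps the path above some \<open>c > l\<close>; up
  to an earlier time \<open>s0\<close> the running infimum does so. The result is one margin
  \<open>d\<close> valid on all of \<open>[0,t)\<close>, which excludes any approach to
  \<open>l\<close>.\<close>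

lemma left_limit_gt:
  assumes lim: "(w \<longlongrightarrow> L) (at_left t)" and "0 < t" "l < L"
    and pre: "\<And>s. 0 \<le> s \<Longrightarrow> s < t \<Longrightarrow> l < rinf w s"
  obtains d where "l < d" "\<And>s. 0 \<le> s \<Longrightarrow> s < t \<Longrightarrow> d \<le> w s"
proof -
  obtain c where c: "l < c" "c < L" using dense[OF assms(3)] by blast
  obtain b where b: "b < t" "\<And>y. b < y \<Longrightarrow> y < t \<Longrightarrow> c < w y"
    using order_tendstoD(1)[OF lim c(2)] unfolding eventually_at_left_field by blast
  define s0 where "s0 = max 0 b"
  have s0: "0 \<le> s0" "s0 < t" using b assms(2) by (auto simp: s0_def)
  show thesis
  proof (rule that[of "min c (rinf w s0)"])
    show "l < min c (rinf w s0)" using c pre[OF s0] by simp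
    fix s assume s: "0 \<le> s" "s < t"
    show "min c (rinf w s0) \<le> w s"
    proof (cases "s \<le> s0")
      case True
      then show ?thesis using rinf_le[of s s0 w] s by (auto simp: min_le_iff_disj)
    next
      case False
      then have "c < w s" using b(2)[of s] s by (auto simp: s0_def)
      then show ?thesis by (auto simp: min_le_iff_disj)
    qed
  qed
qed

text \<open>Continuity from the right is inherited from the path. From the left, the infimum could
  drop at \<open>t\<close> only through the value \<open>w t\<close>, but a left limit at most
  \<open>w t\<close> makes nearly equal values occur earlier.\<close>

lemma rinf_continuous_on:
  assumes "rc w"
    and left: "\<And>t. 0 < t \<Longrightarrow> ereal t < z \<Longrightarrow> \<exists>L. (w \<longlongrightarrow> L) (at_left t) \<and> L \<le> w t"
  shows "continuous_on {t. 0 \<le> t \<and> ereal t < z} (rinf w)"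
  unfolding continuous_on_def
proof (intro ballI)
  let ?D = "{t. 0 \<le> t \<and> ereal t < z}"
  fix t assume "t \<in> ?D"
  then have t: "0 \<le> t" "ereal t < z" by auto
  show "(rinf w \<longlongrightarrow> rinf w t) (at t within ?D)"
  proof (rule order_tendstoI)
    fix c assume "c < rinf w t"
    then obtain e where e: "e > 0" "c < rinf w (t + e)"
      using rinf_gt_nbhd[OF assms(1) t(1)] by blast
    show "\<forall>\<^sub>F x in at t within ?D. c < rinf w x"
      unfolding eventually_at
    proof (intro exI[of _ e] conjI ballI impI)
      fix x assume "x \<in> ?D" "x \<noteq> t \<and> dist x t < e"
      then have "rinf w (t + e) \<le> rinf w x" by (intro rinf_antimono) (auto simp: dist_real_def)
      then show "c < rinf w x" using e(2) by (rule less_le_trans[rotated])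
    qed (rule e)
  next
    fix c assume c: "rinf w t < c"
    obtain s where s: "s < t" "t = 0 \<or> 0 \<le> s \<and> rinf w s < c"
    proof (cases "t = 0")
      \<comment> \<open>At time 0 the domain has no points to the left, so any negative
        \<open>s\<close> serves.\<close>
      case True then show thesis using that[of "-1"] by auto
    next
      case False
      obtain u where u: "0 \<le> u" "u \<le> t" "w u < c" using rinf_lessD[OF c] by blast
      show thesis
      proof (cases "u < t")
        case True
        then show thesis using that[of u] u rinf_le[of u u w] by (meson le_less_trans order_refl)
      next
        case False
        with u have "u = t" by simp
        obtain L where L: "(w \<longlongrightarrow> L) (at_left t)" "L \<le> w t" using left[of t] t \<open>t \<noteq> 0\<close> by auto
        then have "L < c" using u \<open>u = t\<close> by simp
        obtain b where b: "b < t" "\<And>y. b < y \<Longrightarrow> y < t \<Longrightarrow> w y < c"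
          using order_tendstoD(2)[OF L(1) \<open>L < c\<close>] unfolding eventually_at_left_field by blast
        obtain y where y: "max 0 b < y" "y < t" using dense[of "max 0 b" t] b t \<open>t \<noteq> 0\<close> by auto
        then have "w y < c" using b by auto
        then have "rinf w y < c" using rinf_le[of y y w] y by (auto intro: le_less_trans)
        then show thesis using that[of y] y by auto
      qed
    qed
    show "\<forall>\<^sub>F x in at t within ?D. rinf w x < c"
      unfolding eventually_at
    proof (intro exI[of _ "t - s"] conjI ballI impI)
      show "0 < t - s" using s(1) by auto
      fix x assume x: "x \<in> ?D" "x \<noteq> t \<and> dist x t < t - s"
      show "rinf w x < c"
      proof (cases "x < t")
        case True
        with x have "s < x" by (auto simp: dist_real_def)
        show ?thesis
        proof (cases "0 \<le> s")
          case True
          then show ?thesis using s rinf_antimono[of s x w] \<open>s < x\<close> by (auto intro: le_less_trans)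
        next
          case False
          then have "t = 0" using s by auto
          with x True show ?thesis by auto
        qed
      next
        case False
        then show ?thesis using rinf_antimono[of t x w] c by (auto intro: le_less_trans)
      qed
    qed
  qed
qed

section \<open>Measurability\<close>

lemma path_coordinate_measurable:
  "0 \<le> t \<Longrightarrow> (\<lambda>w. w t) \<in> borel_measurable path_meas"
  unfolding path_meas_def by (rule measurable_component_singleton) simp

lemma qinf_measurable:
  fixes Y :: "real \<Rightarrow> 'b \<Rightarrow> ereal"
  assumes "\<And>s. 0 \<le> s \<Longrightarrow> s \<le> t \<Longrightarrow> Y s \<in> borel_measurable M" "0 \<le> t"
  shows "(\<lambda>\<omega>. qinf (\<lambda>s. Y s \<omega>) t) \<in> borel_measurable M"
  unfolding qinf_def
  by (intro borel_measurable_min borel_measurable_INF countable_Int1 countable_rat)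
    (use assms in auto)

lemma qhit_measurable [measurable]: "(\<lambda>w. qhit w l) \<in> borel_measurable path_meas"
  unfolding qhit_def
proof (intro borel_measurable_INF countable_Int1 countable_rat)
  fix s :: real assume "s \<in> \<rat> \<inter> {0..}"
  then have [measurable]: "(\<lambda>w. qinf w s) \<in> borel_measurable path_meas"
    by (intro qinf_measurable path_coordinate_measurable) auto
  show "(\<lambda>w. if qinf w s \<le> ereal l then ereal s else \<infinity>) \<in> borel_measurable path_meas"
    by measurable
qed

lemma qlife_measurable [measurable]: "qlife \<in> borel_measurable path_meas"
proof -
  have "(\<lambda>w. INF s\<in>\<rat> \<inter> {0..}. if w s = \<infinity> then ereal s else \<infinity>) \<in> borel_measurable path_meas"
  proof (intro borel_measurable_INF countable_Int1 countable_rat)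
    fix s :: real assume "s \<in> \<rat> \<inter> {0..}"
    then have [measurable]: "(\<lambda>w. w s) \<in> borel_measurable path_meas"
      by (intro path_coordinate_measurable) auto
    show "(\<lambda>w. if w s = \<infinity> then ereal s else \<infinity>) \<in> borel_measurable path_meas"
      by measurable
  qed
  then show ?thesis by (simp add: qlife_def[abs_def])
qed

text \<open>As \<open>real_of_ereal\<close> sends \<open>\<infinity>\<close> to 0, an infinite time
  gets weight 1 instead of 0; the indicator of being before the lifetime removes such times from the
  integrands in which passage laws are expressed.\<close>

definition disc :: "real \<Rightarrow> ereal \<Rightarrow> ennreal" where
  "disc q t = ennreal (exp (- q * real_of_ereal t))"

lemma disc_measurable [measurable]: "disc q \<in> borel_measurable borel"
  unfolding disc_def[abs_def] by measurable

text \<open>The discounted passage indicator read off the path alone, lifetime included, so that it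
  can be inserted as \<open>H\<close> in the strong Markov property.\<close>

definition hit_functional :: "real \<Rightarrow> real \<Rightarrow> (real \<Rightarrow> ereal) \<Rightarrow> ennreal" where
  "hit_functional q l w = disc q (qhit w l) * indicator {w. qhit w l < qlife w} w"

lemma hit_functional_measurable: "hit_functional q l \<in> borel_measurable path_meas"
proof -
  have "(\<lambda>w. disc q (qhit w l) * (if qhit w l < qlife w then 1 else 0)) \<in> borel_measurable path_meas"
    by measurable
  also have "(\<lambda>w. disc q (qhit w l) * (if qhit w l < qlife w then 1 else 0)) = hit_functional q l"
    by (auto simp: hit_functional_def fun_eq_iff)
  finally show ?thesis .
qed

lemma disc_le_1: "0 \<le> q \<Longrightarrow> 0 \<le> t \<Longrightarrow> disc q t \<le> 1"
  by (simp add: disc_def real_of_ereal_pos)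

lemma disc_pos: "0 < disc q t"
  by (simp add: disc_def)

lemma random_time_measurable:
  fixes T :: "'b \<Rightarrow> ereal"
  assumes "\<And>\<omega>. \<omega> \<in> space M \<Longrightarrow> 0 \<le> T \<omega>"
    and "\<And>t. 0 \<le> t \<Longrightarrow> {\<omega>\<in>space M. T \<omega> \<le> ereal t} \<in> sets M"
  shows "T \<in> borel_measurable M"
proof (rule borel_measurableI_le)
  fix y :: ereal
  show "{\<omega>\<in>space M. T \<omega> \<le> y} \<in> sets M"
  proof (cases "0 \<le> y")
    case True
    then show ?thesis using assms(2) by (cases y) auto
  next
    case False
    have "{\<omega>\<in>space M. T \<omega> \<le> y} = {}" using assms(1) False by (auto dest: order_trans)
    then show ?thesis by (metis sets.empty_sets)
  qed
qed

text \<open>The strong Markov identity is stated on events prior to \<open>S\<close>, whereas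
  discounting uses a weight measurable with respect to those events. Induction over measurable
  functions bridges the two.\<close>

lemma nn_integral_weighted_mono:
  fixes u v g :: "'b \<Rightarrow> ennreal"
  assumes sub: "sets N \<subseteq> sets M" "space N = space M"
    and [measurable]: "u \<in> borel_measurable M" "v \<in> borel_measurable M"
    and le: "\<And>A. A \<in> sets N \<Longrightarrow> (\<integral>\<^sup>+\<omega>. u \<omega> * indicator A \<omega> \<partial>M) \<le> (\<integral>\<^sup>+\<omega>. v \<omega> * indicator A \<omega> \<partial>M)"
    and g: "g \<in> borel_measurable N"
  shows "(\<integral>\<^sup>+\<omega>. u \<omega> * g \<omega> \<partial>M) \<le> (\<integral>\<^sup>+\<omega>. v \<omega> * g \<omega> \<partial>M)"
proof -
  have M: "f \<in> borel_measurable M" if "f \<in> borel_measurable N" for f :: "'b \<Rightarrow> ennreal"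
    using that sub unfolding measurable_def by auto
  show ?thesis
    using g
  proof (induction rule: borel_measurable_induct)
    case (cong f g)
    have "(\<integral>\<^sup>+\<omega>. u \<omega> * g \<omega> \<partial>M) = (\<integral>\<^sup>+\<omega>. u \<omega> * f \<omega> \<partial>M)"
      "(\<integral>\<^sup>+\<omega>. v \<omega> * g \<omega> \<partial>M) = (\<integral>\<^sup>+\<omega>. v \<omega> * f \<omega> \<partial>M)"
      using cong sub by (auto intro!: nn_integral_cong)
    then show ?case using cong by simp
  next
    case (set A)
    then show ?case using le by simp
  next
    case (mult f c)
    note [measurable] = M[OF mult(2)]
    have "(\<integral>\<^sup>+\<omega>. h \<omega> * (c * f \<omega>) \<partial>M) = c * (\<integral>\<^sup>+\<omega>. h \<omega> * f \<omega> \<partial>M)"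
      if [measurable]: "h \<in> borel_measurable M" for h :: "'b \<Rightarrow> ennreal"
      by (subst nn_integral_cmult[symmetric]) (auto simp: ac_simps)
    then show ?case using mult by (simp add: mult_left_mono)
  next
    case (add f g)
    note [measurable] = M[OF add(1)] M[OF add(3)]
    have "(\<integral>\<^sup>+\<omega>. h \<omega> * (f \<omega> + g \<omega>) \<partial>M) = (\<integral>\<^sup>+\<omega>. h \<omega> * f \<omega> \<partial>M) + (\<integral>\<^sup>+\<omega>. h \<omega> * g \<omega> \<partial>M)"
      if [measurable]: "h \<in> borel_measurable M" for h :: "'b \<Rightarrow> ennreal"
      by (subst nn_integral_add[symmetric]) (auto simp: distrib_left)
    then show ?case using add by (simp add: add_mono add.commute)
  next
    case (seq U)
    note [measurable] = M[OF seq(1)]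
    have *: "(\<integral>\<^sup>+\<omega>. h \<omega> * (SUP i. U i) \<omega> \<partial>M) = (SUP i. \<integral>\<^sup>+\<omega>. h \<omega> * U i \<omega> \<partial>M)"
      if [measurable]: "h \<in> borel_measurable M" for h :: "'b \<Rightarrow> ennreal"
    proof -
      have "(\<integral>\<^sup>+\<omega>. h \<omega> * (SUP i. U i) \<omega> \<partial>M) = (\<integral>\<^sup>+\<omega>. (SUP i. h \<omega> * U i \<omega>) \<partial>M)"
        by (simp add: SUP_mult_left_ennreal image_comp)
      also have "\<dots> = (SUP i. \<integral>\<^sup>+\<omega>. h \<omega> * U i \<omega> \<partial>M)"
        by (rule nn_integral_monotone_convergence_SUP)
          (use seq(3) in \<open>auto simp: incseq_def le_fun_def intro!: mult_left_mono\<close>)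
      finally show ?thesis .
    qed
    have "(SUP i. \<integral>\<^sup>+\<omega>. u \<omega> * U i \<omega> \<partial>M) \<le> (SUP i. \<integral>\<^sup>+\<omega>. v \<omega> * U i \<omega> \<partial>M)"
      by (rule SUP_mono) (use seq in blast)
    then show ?case by (simp only: *[OF assms(3)] *[OF assms(4)] seq)
  qed
qed

section \<open>Stopping times and the strong Markov property\<close>

locale markov_setting =
  fixes I :: "real set" and \<Omega> :: "'a set" and F :: "real \<Rightarrow> 'a set set"
    and P :: "real \<Rightarrow> 'a measure" and X :: "real \<Rightarrow> 'a \<Rightarrow> ereal" and \<zeta> :: "'a \<Rightarrow> ereal"
  assumes setting: "standing_setting I \<Omega> F P X \<zeta>"
begin

section \<open>The standing setting, unpacked\<close>

lemma interval_I: "is_interval I"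
  and I_unbounded: "\<forall>b. \<exists>x\<in>I. b < x"
  and I_nonempty: "I \<noteq> {}"
  using setting unfolding standing_setting_def by - (elim conjE, assumption)+

lemma F_sigma: "0 \<le> t \<Longrightarrow> sigma_algebra \<Omega> (F t)"
  and F_mono: "0 \<le> s \<Longrightarrow> s \<le> t \<Longrightarrow> F s \<subseteq> F t"
proof -
  have "\<forall>t\<ge>0. sigma_algebra \<Omega> (F t)" "\<forall>s t. 0 \<le> s \<longrightarrow> s \<le> t \<longrightarrow> F s \<subseteq> F t"
    using setting unfolding standing_setting_def by - (elim conjE, assumption)+
  then show "0 \<le> t \<Longrightarrow> sigma_algebra \<Omega> (F t)" "0 \<le> s \<Longrightarrow> s \<le> t \<Longrightarrow> F s \<subseteq> F t" by blast+
qed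

lemma prob_P: "x \<in> I \<Longrightarrow> prob_space (P x)"
  and complete_P: "x \<in> I \<Longrightarrow> complete_measure (P x)"
  and space_P: "x \<in> I \<Longrightarrow> space (P x) = \<Omega>"
  and Finf_sets: "x \<in> I \<Longrightarrow> Finf \<Omega> F \<subseteq> sets (P x)"
proof -
  have *: "\<forall>x\<in>I. prob_space (P x) \<and> complete_measure (P x) \<and> space (P x) = \<Omega> \<and> Finf \<Omega> F \<subseteq> sets (P x)"
    using setting unfolding standing_setting_def by - (elim conjE, assumption)
  show "x \<in> I \<Longrightarrow> prob_space (P x)" "x \<in> I \<Longrightarrow> complete_measure (P x)"
    "x \<in> I \<Longrightarrow> space (P x) = \<Omega>" "x \<in> I \<Longrightarrow> Finf \<Omega> F \<subseteq> sets (P x)" using * by blast+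
qed

lemma adapted:
  assumes "0 \<le> t" "B \<in> sets (borel :: ereal measure)"
  shows "{\<omega>\<in>\<Omega>. X t \<omega> \<in> B} \<in> F t"
proof -
  have "\<forall>t\<ge>0. \<forall>B\<in>sets (borel :: ereal measure). {\<omega>\<in>\<Omega>. X t \<omega> \<in> B} \<in> F t"
    using setting unfolding standing_setting_def by - (elim conjE, assumption)
  with assms show ?thesis by blast
qed

lemma zeta_fstop: "fstop \<Omega> F \<zeta>"
  using setting unfolding standing_setting_def by - (elim conjE, assumption)

lemma zeta_pos: "x \<in> I \<Longrightarrow> AE \<omega> in P x. 0 < \<zeta> \<omega>"
proof -
  have "\<forall>x\<in>I. AE \<omega> in P x. 0 < \<zeta> \<omega>"
    using setting unfolding standing_setting_def by - (elim conjE, assumption)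
  then show "x \<in> I \<Longrightarrow> AE \<omega> in P x. 0 < \<zeta> \<omega>" by blast
qed

lemma cemetery: "\<omega> \<in> \<Omega> \<Longrightarrow> 0 \<le> t \<Longrightarrow> \<zeta> \<omega> \<le> ereal t \<Longrightarrow> X t \<omega> = \<infinity>"
proof -
  have "\<forall>\<omega>\<in>\<Omega>. \<forall>t\<ge>0. \<zeta> \<omega> \<le> ereal t \<longrightarrow> X t \<omega> = \<infinity>"
    using setting unfolding standing_setting_def by - (elim conjE, assumption)
  then show "\<omega> \<in> \<Omega> \<Longrightarrow> 0 \<le> t \<Longrightarrow> \<zeta> \<omega> \<le> ereal t \<Longrightarrow> X t \<omega> = \<infinity>" by blast
qed

lemma cadlag:
  assumes "\<omega> \<in> \<Omega>" "0 \<le> t" "ereal t < \<zeta> \<omega>"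
  shows "X t \<omega> \<in> ereal ` I" "((\<lambda>s. X s \<omega>) \<longlongrightarrow> X t \<omega>) (at_right t)"
    "0 < t \<Longrightarrow> \<exists>l\<in>I. ((\<lambda>s. X s \<omega>) \<longlongrightarrow> ereal l) (at_left t)"
proof -
  have "\<forall>\<omega>\<in>\<Omega>. \<forall>t. 0 \<le> t \<and> ereal t < \<zeta> \<omega> \<longrightarrow>
       X t \<omega> \<in> ereal ` I \<and> ((\<lambda>s. X s \<omega>) \<longlongrightarrow> X t \<omega>) (at_right t) \<and>
       (0 < t \<longrightarrow> (\<exists>l\<in>I. ((\<lambda>s. X s \<omega>) \<longlongrightarrow> ereal l) (at_left t)))"
    using setting unfolding standing_setting_def by - (elim conjE, assumption)
  with assms show "X t \<omega> \<in> ereal ` I" "((\<lambda>s. X s \<omega>) \<longlongrightarrow> X t \<omega>) (at_right t)"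
    "0 < t \<Longrightarrow> \<exists>l\<in>I. ((\<lambda>s. X s \<omega>) \<longlongrightarrow> ereal l) (at_left t)" by blast+
qed

lemma lifetime_left_limit:
  assumes "x \<in> I"
  shows "AE \<omega> in P x. 0 < \<zeta> \<omega> \<and> \<zeta> \<omega> < \<infinity> \<longrightarrow>
       (\<exists>l. (l \<in> ereal ` I \<or> l = \<infinity>) \<and>
            ((\<lambda>s. X s \<omega>) \<longlongrightarrow> l) (at_left (real_of_ereal (\<zeta> \<omega>))))"
proof -
  have "\<forall>x\<in>I. AE \<omega> in P x. 0 < \<zeta> \<omega> \<and> \<zeta> \<omega> < \<infinity> \<longrightarrow>
       (\<exists>l. (l \<in> ereal ` I \<or> l = \<infinity>) \<and>
            ((\<lambda>s. X s \<omega>) \<longlongrightarrow> l) (at_left (real_of_ereal (\<zeta> \<omega>))))"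
    using setting unfolding standing_setting_def by - (elim conjE, assumption)
  with assms show ?thesis by blast
qed

lemma normality: "x \<in> I \<Longrightarrow> AE \<omega> in P x. X 0 \<omega> = ereal x"
proof -
  have "\<forall>x\<in>I. AE \<omega> in P x. X 0 \<omega> = ereal x"
    using setting unfolding standing_setting_def by - (elim conjE, assumption)
  then show "x \<in> I \<Longrightarrow> AE \<omega> in P x. X 0 \<omega> = ereal x" by blast
qed

lemma strong_markov:
  assumes "fstop \<Omega> F S" "H \<in> borel_measurable path_meas" "A \<in> pre_stop \<Omega> F S" "x \<in> I"
  shows "(\<integral>\<^sup>+\<omega>. H (shift X (real_of_ereal (S \<omega>)) \<omega>) * indicator (A \<inter> {\<omega>. S \<omega> < \<zeta> \<omega>}) \<omega> \<partial>P x)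
       = (\<integral>\<^sup>+\<omega>. (\<integral>\<^sup>+\<omega>'. H (shift X 0 \<omega>') \<partial>P (real_of_ereal (at_time X S \<omega>)))
                 * indicator (A \<inter> {\<omega>. S \<omega> < \<zeta> \<omega>}) \<omega> \<partial>P x)"
proof -
  have "\<forall>S H A x. fstop \<Omega> F S \<longrightarrow> H \<in> borel_measurable path_meas \<longrightarrow>
       A \<in> pre_stop \<Omega> F S \<longrightarrow> x \<in> I \<longrightarrow>
       (\<integral>\<^sup>+\<omega>. H (shift X (real_of_ereal (S \<omega>)) \<omega>) * indicator (A \<inter> {\<omega>. S \<omega> < \<zeta> \<omega>}) \<omega> \<partial>P x)
       = (\<integral>\<^sup>+\<omega>. (\<integral>\<^sup>+\<omega>'. H (shift X 0 \<omega>') \<partial>P (real_of_ereal (at_time X S \<omega>)))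
                 * indicator (A \<inter> {\<omega>. S \<omega> < \<zeta> \<omega>}) \<omega> \<partial>P x)"
    using setting unfolding standing_setting_def by - (elim conjE, assumption)
  with assms show ?thesis by blast
qed

lemma quasi_left_continuity:
  assumes "\<And>n. fstop \<Omega> F (Tn n)" "fstop \<Omega> F T"
    and "\<And>x. x \<in> I \<Longrightarrow> AE \<omega> in P x. incseq (\<lambda>n. Tn n \<omega>) \<and> (\<lambda>n. Tn n \<omega>) \<longlonglongrightarrow> T \<omega>"
    and "x \<in> I"
  shows "AE \<omega> in P x. T \<omega> < \<zeta> \<omega> \<longrightarrow> (\<lambda>n. at_time X (Tn n) \<omega>) \<longlonglongrightarrow> at_time X T \<omega>"
proof -
  have "\<forall>Tn T. (\<forall>n. fstop \<Omega> F (Tn n)) \<longrightarrow> fstop \<Omega> F T \<longrightarrow>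
       (\<forall>x\<in>I. AE \<omega> in P x. incseq (\<lambda>n. Tn n \<omega>) \<and> (\<lambda>n. Tn n \<omega>) \<longlonglongrightarrow> T \<omega>) \<longrightarrow>
       (\<forall>x\<in>I. AE \<omega> in P x. T \<omega> < \<zeta> \<omega> \<longrightarrow>
          (\<lambda>n. at_time X (Tn n) \<omega>) \<longlonglongrightarrow> at_time X T \<omega>)"
    using setting unfolding standing_setting_def by - (elim conjE, assumption)
  with assms show ?thesis by blast
qed

lemma non_announceability:
  assumes "\<And>n. fstop \<Omega> F (Tn n)"
    and "\<And>x. x \<in> I \<Longrightarrow> AE \<omega> in P x. incseq (\<lambda>n. Tn n \<omega>)"
    and "x \<in> I"
  shows "AE \<omega> in P x. \<not> ((\<forall>n. Tn n \<omega> < \<zeta> \<omega>) \<and> (\<lambda>n. Tn n \<omega>) \<longlonglongrightarrow> \<zeta> \<omega> \<and>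
                                   \<zeta> \<omega> < \<infinity> \<and> zeta_minus I X \<zeta> \<omega> < \<infinity>)"
proof -
  have "\<forall>Tn. (\<forall>n. fstop \<Omega> F (Tn n)) \<longrightarrow>
       (\<forall>x\<in>I. AE \<omega> in P x. incseq (\<lambda>n. Tn n \<omega>)) \<longrightarrow>
       (\<forall>x\<in>I. AE \<omega> in P x. \<not> ((\<forall>n. Tn n \<omega> < \<zeta> \<omega>) \<and> (\<lambda>n. Tn n \<omega>) \<longlonglongrightarrow> \<zeta> \<omega> \<and>
                                   \<zeta> \<omega> < \<infinity> \<and> zeta_minus I X \<zeta> \<omega> < \<infinity>))"
    using setting unfolding standing_setting_def by - (elim conjE, assumption)
  with assms show ?thesis by blast
qed

lemma zeta_nonneg: "\<omega> \<in> \<Omega> \<Longrightarrow> 0 \<le> \<zeta> \<omega>"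
  using zeta_fstop unfolding fstop_def by blast

lemma X_infinite_iff: "\<omega> \<in> \<Omega> \<Longrightarrow> 0 \<le> t \<Longrightarrow> X t \<omega> = \<infinity> \<longleftrightarrow> \<zeta> \<omega> \<le> ereal t"
  using cemetery[of \<omega> t] cadlag(1)[of \<omega> t] by (cases "\<zeta> \<omega> \<le> ereal t") (auto simp: not_le)

lemma path_rc:
  assumes "\<omega> \<in> \<Omega>"
  shows "rc (\<lambda>t. X t \<omega>)"
  unfolding rc_def
proof (intro allI impI)
  fix t :: real assume t: "0 \<le> t"
  show "((\<lambda>t. X t \<omega>) \<longlongrightarrow> X t \<omega>) (at_right t)"
  proof (cases "ereal t < \<zeta> \<omega>")
    case False
    then have "X s \<omega> = \<infinity>" if "t \<le> s" for s
      using that t assms by (intro cemetery) (auto simp: not_less intro: order_trans)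
    then have "\<forall>\<^sub>F s in at_right t. X s \<omega> = X t \<omega>"
      unfolding eventually_at_right_field by (intro exI[of _ "t + 1"]) auto
    then show ?thesis by (rule tendsto_eventually)
  qed (use cadlag assms t in blast)
qed

definition tau :: "real \<Rightarrow> 'a \<Rightarrow> ereal" where
  "tau l \<omega> = hit (\<lambda>t. X t \<omega>) l"

lemma tau_nonneg: "0 \<le> tau l \<omega>"
  by (simp add: tau_def hit_nonneg)

text \<open>By \<open>hit_le_iff\<close> and \<open>qinf_eq_rinf\<close>, passage by time
  \<open>t\<close> is a condition on countably many coordinates up to \<open>t\<close>, so the event
  lies in \<open>F t\<close> itself and no later information enters.\<close>

lemma tau_fstop: "fstop \<Omega> F (tau l)"
  unfolding fstop_def
proof (intro conjI ballI allI impI)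
  fix t :: real assume t: "0 \<le> t"
  interpret sigma_algebra \<Omega> "F t" using F_sigma[OF t] .
  let ?M = "sigma \<Omega> (F t)"
  have sp: "space ?M = \<Omega>" "sets ?M = F t"
    using space_closed by (simp_all add: space_measure_of sets_measure_of_eq)
  have "X s \<in> borel_measurable ?M" if "0 \<le> s" "s \<le> t" for s
    using adapted[OF that(1)] F_mono[OF that] sp
    by (intro measurableI) (auto simp: vimage_def Int_def conj_commute)
  then have "(\<lambda>\<omega>. qinf (\<lambda>s. X s \<omega>) t) \<in> borel_measurable ?M"
    using t by (rule qinf_measurable)
  then have "{\<omega>\<in>space ?M. qinf (\<lambda>s. X s \<omega>) t \<le> ereal l} \<in> sets ?M" by measurable
  moreover have "{\<omega>\<in>\<Omega>. tau l \<omega> \<le> ereal t} = {\<omega>\<in>space ?M. qinf (\<lambda>s. X s \<omega>) t \<le> ereal l}"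
    using sp hit_le_iff[OF path_rc t] qinf_eq_rinf[OF path_rc t] by (auto simp: tau_def)
  ultimately show "{\<omega>\<in>\<Omega>. tau l \<omega> \<le> ereal t} \<in> F t" using sp by simp
qed (rule tau_nonneg)

section \<open>Measurability of the path after a random time\<close>

lemma F_sets_P: "x \<in> I \<Longrightarrow> 0 \<le> t \<Longrightarrow> A \<in> F t \<Longrightarrow> A \<in> sets (P x)"
  using Finf_sets[of x] unfolding Finf_def by (auto intro: sigma_sets.Basic)

lemma fstop_measurable: "fstop \<Omega> F S \<Longrightarrow> x \<in> I \<Longrightarrow> S \<in> borel_measurable (P x)"
  by (rule random_time_measurable) (auto simp: fstop_def space_P intro: F_sets_P)

lemma X_measurable: "x \<in> I \<Longrightarrow> 0 \<le> t \<Longrightarrow> X t \<in> borel_measurable (P x)"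
  by (rule measurableI)
    (use adapted F_sets_P in \<open>auto simp: space_P vimage_def Int_def conj_commute\<close>)

lemma X_random_time_measurable:
  assumes x: "x \<in> I" and R [measurable]: "R \<in> borel_measurable (P x)"
    and nonneg: "\<And>\<omega>. \<omega> \<in> \<Omega> \<Longrightarrow> 0 \<le> R \<omega>"
  shows "(\<lambda>\<omega>. X (R \<omega>) \<omega>) \<in> borel_measurable (P x)"
proof (rule borel_measurable_LIMSEQ_order)
  \<comment> \<open>The random time is approximated by the next grid point of mesh
    \<open>1 / real (Suc n)\<close>. Rounding to the successor of the floor makes the approximation
    strictly larger, as convergence along \<open>at_right\<close> demands.\<close>
  let ?k = "\<lambda>n \<omega>. nat \<lfloor>real (Suc n) * R \<omega>\<rfloor>"
  show "(\<lambda>\<omega>. X (real (Suc (?k n \<omega>)) / real (Suc n)) \<omega>) \<in> borel_measurable (P x)" for n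
  proof (rule measurable_compose_countable[where f = "\<lambda>k \<omega>. X (real (Suc k) / real (Suc n)) \<omega>"])
    show "X (real (Suc k) / real (Suc n)) \<in> borel_measurable (P x)" for k
      by (rule X_measurable[OF x]) simp
    show "?k n \<in> measurable (P x) (count_space UNIV)" by measurable
  qed
  fix \<omega> assume "\<omega> \<in> space (P x)"
  then have w: "\<omega> \<in> \<Omega>" using space_P[OF x] by simp
  let ?y = "\<lambda>n. real (Suc (?k n \<omega>)) / real (Suc n)"
  have lower: "R \<omega> < ?y n" and upper: "?y n \<le> R \<omega> + 1 / real (Suc n)" for n
  proof -
    have "0 \<le> real (Suc n) * R \<omega>" using nonneg[OF w] by simp
    then have k: "real (?k n \<omega>) = of_int \<lfloor>real (Suc n) * R \<omega>\<rfloor>" by simp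
    have "real (Suc n) * R \<omega> < real (Suc (?k n \<omega>))" "real (Suc (?k n \<omega>)) \<le> real (Suc n) * R \<omega> + 1"
      using k by linarith+
    then show "R \<omega> < ?y n" "?y n \<le> R \<omega> + 1 / real (Suc n)"
      by (simp_all add: field_simps del: of_nat_Suc)
  qed
  have "?y \<longlonglongrightarrow> R \<omega>"
  proof (rule tendsto_sandwich[of "\<lambda>_. R \<omega>" _ _ "\<lambda>n. R \<omega> + 1 / real (Suc n)"])
    show "(\<lambda>n. R \<omega> + 1 / real (Suc n)) \<longlonglongrightarrow> R \<omega>"
      using tendsto_add[OF tendsto_const[of "R \<omega>"] LIMSEQ_Suc[OF lim_1_over_n]] by simp
  qed (use lower upper less_imp_le in \<open>auto intro!: always_eventually\<close>)
  then have "filterlim ?y (at_right (R \<omega>)) sequentially"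
    unfolding filterlim_at using lower less_imp_neq[OF lower, symmetric] by (auto intro!: always_eventually)
  then show "(\<lambda>n. X (?y n) \<omega>) \<longlonglongrightarrow> X (R \<omega>) \<omega>"
    by (rule filterlim_compose[OF rcD[OF path_rc[OF w] nonneg[OF w]]])
qed

lemma shift_measurable:
  assumes x: "x \<in> I" and R: "R \<in> borel_measurable (P x)"
    and nonneg: "\<And>\<omega>. \<omega> \<in> \<Omega> \<Longrightarrow> 0 \<le> R \<omega>"
  shows "(\<lambda>\<omega>. shift X (R \<omega>) \<omega>) \<in> measurable (P x) path_meas"
  unfolding shift_def path_meas_def
proof (rule measurable_restrict)
  fix t :: real assume "t \<in> {0..}"
  then show "(\<lambda>\<omega>. X (R \<omega> + t) \<omega>) \<in> borel_measurable (P x)"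
    using R nonneg by (intro X_random_time_measurable[OF x]) auto
qed

section \<open>The sigma-algebra of events prior to a stopping time\<close>

lemma F_subset: "0 \<le> t \<Longrightarrow> A \<in> F t \<Longrightarrow> A \<subseteq> \<Omega>"
  using sigma_algebra_iff2[THEN iffD1, OF F_sigma] by blast

lemma Finf_sigma: "sigma_algebra \<Omega> (Finf \<Omega> F)"
  unfolding Finf_def by (rule sigma_algebra_sigma_sets) (use F_subset in auto)

lemma F_Finf: "0 \<le> t \<Longrightarrow> A \<in> F t \<Longrightarrow> A \<in> Finf \<Omega> F"
  unfolding Finf_def by (auto intro: sigma_sets.Basic)

lemma pre_stop_sigma:
  assumes S: "fstop \<Omega> F S"
  shows "sigma_algebra \<Omega> (pre_stop \<Omega> F S)"
  unfolding sigma_algebra_iff2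
proof (intro conjI ballI allI impI)
  interpret Fi: sigma_algebra \<Omega> "Finf \<Omega> F" by (rule Finf_sigma)
  show "pre_stop \<Omega> F S \<subseteq> Pow \<Omega>" using Fi.sets_into_space by (auto simp: pre_stop_def)
  have St: "{\<omega>\<in>\<Omega>. S \<omega> \<le> ereal t} \<in> F t" if "0 \<le> t" for t using S that by (auto simp: fstop_def)
  show "{} \<in> pre_stop \<Omega> F S"
    using sigma_algebra_iff2[THEN iffD1, OF F_sigma]
    by (auto simp: pre_stop_def)
  show "\<Omega> - A \<in> pre_stop \<Omega> F S" if A: "A \<in> pre_stop \<Omega> F S" for A
    unfolding pre_stop_def
  proof (intro CollectI conjI allI impI)
    show "\<Omega> - A \<in> Finf \<Omega> F" using A by (auto simp: pre_stop_def)
    fix t :: real assume t: "0 \<le> t"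
    interpret sigma_algebra \<Omega> "F t" by (rule F_sigma[OF t])
    have "(\<Omega> - A) \<inter> {\<omega>\<in>\<Omega>. S \<omega> \<le> ereal t} = {\<omega>\<in>\<Omega>. S \<omega> \<le> ereal t} - A \<inter> {\<omega>\<in>\<Omega>. S \<omega> \<le> ereal t}" by auto
    then show "(\<Omega> - A) \<inter> {\<omega>\<in>\<Omega>. S \<omega> \<le> ereal t} \<in> F t"
      using A t St[OF t] by (auto simp: pre_stop_def)
  qed
  show "(\<Union>i. A i) \<in> pre_stop \<Omega> F S" if A: "range A \<subseteq> pre_stop \<Omega> F S" for A :: "nat \<Rightarrow> 'a set"
    unfolding pre_stop_def
  proof (intro CollectI conjI allI impI)
    show "(\<Union>i. A i) \<in> Finf \<Omega> F" using A by (intro Fi.countable_UN) (auto simp: pre_stop_def)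
    fix t :: real assume t: "0 \<le> t"
    interpret sigma_algebra \<Omega> "F t" by (rule F_sigma[OF t])
    have "(\<Union>i. A i \<inter> {\<omega>\<in>\<Omega>. S \<omega> \<le> ereal t}) \<in> F t"
      using A t by (intro countable_UN) (auto simp: pre_stop_def)
    then show "(\<Union>i. A i) \<inter> {\<omega>\<in>\<Omega>. S \<omega> \<le> ereal t} \<in> F t" by (simp only: UN_extend_simps)
  qed
qed

lemma discounted_mono:
  fixes u v :: "'a \<Rightarrow> ennreal"
  assumes S: "fstop \<Omega> F S" and x: "x \<in> I"
    and u: "u \<in> borel_measurable (P x)" and v: "v \<in> borel_measurable (P x)"
    and le: "\<And>A. A \<in> pre_stop \<Omega> F S \<Longrightarrow>
      (\<integral>\<^sup>+\<omega>. u \<omega> * indicator A \<omega> \<partial>P x) \<le> (\<integral>\<^sup>+\<omega>. v \<omega> * indicator A \<omega> \<partial>P x)"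
  shows "(\<integral>\<^sup>+\<omega>. u \<omega> * disc q (S \<omega>) \<partial>P x) \<le> (\<integral>\<^sup>+\<omega>. v \<omega> * disc q (S \<omega>) \<partial>P x)"
proof -
  interpret sigma_algebra \<Omega> "pre_stop \<Omega> F S" by (rule pre_stop_sigma[OF S])
  let ?N = "sigma \<Omega> (pre_stop \<Omega> F S)"
  have sp: "space ?N = \<Omega>" "sets ?N = pre_stop \<Omega> F S"
    using space_closed by (simp_all add: space_measure_of sets_measure_of_eq)
  \<comment> \<open>\<open>S\<close> is measurable with respect to its own prior events:
    intersecting with the event up to \<open>r\<close> gives the event up to
    \<open>min t r\<close>.\<close>
  have "{\<omega>\<in>\<Omega>. S \<omega> \<le> ereal t} \<in> pre_stop \<Omega> F S" if t: "0 \<le> t" for t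
    unfolding pre_stop_def
  proof (intro CollectI conjI allI impI)
    show "{\<omega>\<in>\<Omega>. S \<omega> \<le> ereal t} \<in> Finf \<Omega> F" using S t F_Finf by (auto simp: fstop_def)
    fix r :: real assume r: "0 \<le> r"
    have "0 \<le> min t r" using t r by simp
    then have "{\<omega>\<in>\<Omega>. S \<omega> \<le> ereal (min t r)} \<in> F (min t r)"
      using S unfolding fstop_def by blast
    then have "{\<omega>\<in>\<Omega>. S \<omega> \<le> ereal (min t r)} \<in> F r"
      using F_mono[OF \<open>0 \<le> min t r\<close>, of r] by auto
    also have "{\<omega>\<in>\<Omega>. S \<omega> \<le> ereal (min t r)} = {\<omega>\<in>\<Omega>. S \<omega> \<le> ereal t} \<inter> {\<omega>\<in>\<Omega>. S \<omega> \<le> ereal r}"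
      by (auto simp: ereal_min)
    finally show "{\<omega>\<in>\<Omega>. S \<omega> \<le> ereal t} \<inter> {\<omega>\<in>\<Omega>. S \<omega> \<le> ereal r} \<in> F r" .
  qed
  then have "S \<in> borel_measurable ?N"
    using S by (intro random_time_measurable) (auto simp: sp fstop_def)
  then have "(\<lambda>\<omega>. disc q (S \<omega>)) \<in> borel_measurable ?N" by measurable
  moreover have "sets ?N \<subseteq> sets (P x)" unfolding sp using Finf_sets[OF x] by (auto simp: pre_stop_def)
  moreover have "space ?N = space (P x)" by (simp only: sp space_P[OF x])
  ultimately show ?thesis
    using nn_integral_weighted_mono[of ?N "P x" u v] u v le unfolding sp by blast
qed

section \<open>One-sided discounted forms of the strong Markov property\<close>

lemma stop_shift_measurable:
  assumes S: "fstop \<Omega> F S" and x: "x \<in> I" and H: "H \<in> borel_measurable path_meas"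
  shows "(\<lambda>\<omega>. H (shift X (real_of_ereal (S \<omega>)) \<omega>)) \<in> borel_measurable (P x)"
proof -
  note [measurable] = fstop_measurable[OF S x]
  show ?thesis
    by (rule measurable_compose[OF shift_measurable[OF x] H])
      (use S in \<open>auto simp: fstop_def real_of_ereal_pos\<close>)
qed

lemma alive_indicator_measurable:
  assumes S: "fstop \<Omega> F S" and x: "x \<in> I"
  shows "(\<lambda>\<omega>. indicator {\<omega>. S \<omega> < \<zeta> \<omega>} \<omega> :: ennreal) \<in> borel_measurable (P x)"
proof -
  note [measurable] = fstop_measurable[OF S x] fstop_measurable[OF zeta_fstop x]
  have "(\<lambda>\<omega>. if S \<omega> < \<zeta> \<omega> then 1 else 0 :: ennreal) \<in> borel_measurable (P x)" by measurable
  also have "(\<lambda>\<omega>. if S \<omega> < \<zeta> \<omega> then 1 else 0 :: ennreal) = (\<lambda>\<omega>. indicator {\<omega>. S \<omega> < \<zeta> \<omega>} \<omega>)"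
    by (auto simp: fun_eq_iff)
  finally show ?thesis .
qed

text \<open>The weighted comparison asks for measurable integrands, and measurability of the inner
  expectation in \<open>\<omega>\<close> is not established here. A measurable bound
  \<open>u\<close> stands in for it, whence the two one-sided versions.\<close>

lemma strong_markov_discounted_ge:
  fixes u :: "'a \<Rightarrow> ennreal"
  assumes S: "fstop \<Omega> F S" and x: "x \<in> I" and H: "H \<in> borel_measurable path_meas"
    and u [measurable]: "u \<in> borel_measurable (P x)"
    and le: "AE \<omega> in P x. S \<omega> < \<zeta> \<omega> \<longrightarrow>
      u \<omega> \<le> (\<integral>\<^sup>+\<omega>'. H (shift X 0 \<omega>') \<partial>P (real_of_ereal (at_time X S \<omega>)))"
  shows "(\<integral>\<^sup>+\<omega>. u \<omega> * indicator {\<omega>. S \<omega> < \<zeta> \<omega>} \<omega> * disc q (S \<omega>) \<partial>P x)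
    \<le> (\<integral>\<^sup>+\<omega>. H (shift X (real_of_ereal (S \<omega>)) \<omega>) * indicator {\<omega>. S \<omega> < \<zeta> \<omega>} \<omega> * disc q (S \<omega>) \<partial>P x)"
proof (rule discounted_mono[OF S x])
  note [measurable] = stop_shift_measurable[OF S x H] alive_indicator_measurable[OF S x]
  show "(\<lambda>\<omega>. u \<omega> * indicator {\<omega>. S \<omega> < \<zeta> \<omega>} \<omega>) \<in> borel_measurable (P x)"
    "(\<lambda>\<omega>. H (shift X (real_of_ereal (S \<omega>)) \<omega>) * indicator {\<omega>. S \<omega> < \<zeta> \<omega>} \<omega>) \<in> borel_measurable (P x)"
    by measurable
  fix A assume A: "A \<in> pre_stop \<Omega> F S"
  have "(\<integral>\<^sup>+\<omega>. u \<omega> * indicator {\<omega>. S \<omega> < \<zeta> \<omega>} \<omega> * indicator A \<omega> \<partial>P x)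
    \<le> (\<integral>\<^sup>+\<omega>. (\<integral>\<^sup>+\<omega>'. H (shift X 0 \<omega>') \<partial>P (real_of_ereal (at_time X S \<omega>)))
                 * indicator (A \<inter> {\<omega>. S \<omega> < \<zeta> \<omega>}) \<omega> \<partial>P x)"
    by (rule nn_integral_mono_AE) (use le in \<open>auto simp: indicator_def\<close>)
  also have "\<dots> = (\<integral>\<^sup>+\<omega>. H (shift X (real_of_ereal (S \<omega>)) \<omega>) * indicator (A \<inter> {\<omega>. S \<omega> < \<zeta> \<omega>}) \<omega> \<partial>P x)"
    using strong_markov[OF S H A x] by simp
  also have "\<dots> = (\<integral>\<^sup>+\<omega>. H (shift X (real_of_ereal (S \<omega>)) \<omega>) * indicator {\<omega>. S \<omega> < \<zeta> \<omega>} \<omega> * indicator A \<omega> \<partial>P x)"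
    by (intro nn_integral_cong) (auto simp: indicator_def)
  finally show "(\<integral>\<^sup>+\<omega>. u \<omega> * indicator {\<omega>. S \<omega> < \<zeta> \<omega>} \<omega> * indicator A \<omega> \<partial>P x) \<le> \<dots>" .
qed

lemma strong_markov_discounted_le:
  fixes u :: "'a \<Rightarrow> ennreal"
  assumes S: "fstop \<Omega> F S" and x: "x \<in> I" and H: "H \<in> borel_measurable path_meas"
    and u [measurable]: "u \<in> borel_measurable (P x)"
    and le: "AE \<omega> in P x. S \<omega> < \<zeta> \<omega> \<longrightarrow>
      (\<integral>\<^sup>+\<omega>'. H (shift X 0 \<omega>') \<partial>P (real_of_ereal (at_time X S \<omega>))) \<le> u \<omega>"
  shows "(\<integral>\<^sup>+\<omega>. H (shift X (real_of_ereal (S \<omega>)) \<omega>) * indicator {\<omega>. S \<omega> < \<zeta> \<omega>} \<omega> * disc q (S \<omega>) \<partial>P x)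
    \<le> (\<integral>\<^sup>+\<omega>. u \<omega> * indicator {\<omega>. S \<omega> < \<zeta> \<omega>} \<omega> * disc q (S \<omega>) \<partial>P x)"
proof (rule discounted_mono[OF S x])
  note [measurable] = stop_shift_measurable[OF S x H] alive_indicator_measurable[OF S x]
  show "(\<lambda>\<omega>. u \<omega> * indicator {\<omega>. S \<omega> < \<zeta> \<omega>} \<omega>) \<in> borel_measurable (P x)"
    "(\<lambda>\<omega>. H (shift X (real_of_ereal (S \<omega>)) \<omega>) * indicator {\<omega>. S \<omega> < \<zeta> \<omega>} \<omega>) \<in> borel_measurable (P x)"
    by measurable
  fix A assume A: "A \<in> pre_stop \<Omega> F S"
  have "(\<integral>\<^sup>+\<omega>. H (shift X (real_of_ereal (S \<omega>)) \<omega>) * indicator {\<omega>. S \<omega> < \<zeta> \<omega>} \<omega> * indicator A \<omega> \<partial>P x)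
    = (\<integral>\<^sup>+\<omega>. H (shift X (real_of_ereal (S \<omega>)) \<omega>) * indicator (A \<inter> {\<omega>. S \<omega> < \<zeta> \<omega>}) \<omega> \<partial>P x)"
    by (intro nn_integral_cong) (auto simp: indicator_def)
  also have "\<dots> = (\<integral>\<^sup>+\<omega>. (\<integral>\<^sup>+\<omega>'. H (shift X 0 \<omega>') \<partial>P (real_of_ereal (at_time X S \<omega>)))
                 * indicator (A \<inter> {\<omega>. S \<omega> < \<zeta> \<omega>}) \<omega> \<partial>P x)"
    using strong_markov[OF S H A x] by simp
  also have "\<dots> \<le> (\<integral>\<^sup>+\<omega>. u \<omega> * indicator {\<omega>. S \<omega> < \<zeta> \<omega>} \<omega> * indicator A \<omega> \<partial>P x)"
    by (rule nn_integral_mono_AE) (use le in \<open>auto simp: indicator_def\<close>)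
  finally show "(\<integral>\<^sup>+\<omega>. H (shift X (real_of_ereal (S \<omega>)) \<omega>) * indicator {\<omega>. S \<omega> < \<zeta> \<omega>} \<omega> * indicator A \<omega> \<partial>P x)
    \<le> (\<integral>\<^sup>+\<omega>. u \<omega> * indicator {\<omega>. S \<omega> < \<zeta> \<omega>} \<omega> * indicator A \<omega> \<partial>P x)" .
qed

section \<open>Passage functionals of shifted paths\<close>

lemma qhit_shift:
  assumes "\<omega> \<in> \<Omega>" "0 \<le> s"
  shows "qhit (shift X s \<omega>) l = hit (\<lambda>t. X (s + t) \<omega>) l"
proof -
  have eq: "X (s + t) \<omega> = shift X s \<omega> t" if "0 \<le> t" for t using that by (simp add: shift_def)
  have "rc (shift X s \<omega>)" by (rule rc_cong[OF rc_shift[OF path_rc] eq]) (use assms in auto)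
  then show ?thesis using hit_cong[OF eq] by (simp add: qhit_eq_hit)
qed

lemma qlife_shift:
  assumes "\<omega> \<in> \<Omega>" "0 \<le> s" "ereal s \<le> \<zeta> \<omega>"
  shows "qlife (shift X s \<omega>) = \<zeta> \<omega> - ereal s"
proof (rule qlife_eq)
  fix t :: real assume t: "0 \<le> t"
  have "shift X s \<omega> t = \<infinity> \<longleftrightarrow> \<zeta> \<omega> \<le> ereal (s + t)"
    using X_infinite_iff[OF assms(1), of "s + t"] t assms(2) by (simp add: shift_def)
  then show "shift X s \<omega> t = \<infinity> \<longleftrightarrow> \<zeta> \<omega> - ereal s \<le> ereal t"
    using assms(3) by (cases "\<zeta> \<omega>") auto
qed (use assms in \<open>cases "\<zeta> \<omega>"; auto\<close>)

lemma hit_functional_start: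
  assumes "\<omega> \<in> \<Omega>"
  shows "hit_functional q l (shift X 0 \<omega>) = disc q (tau l \<omega>) * indicator {\<omega>. tau l \<omega> < \<zeta> \<omega>} \<omega>"
  using qhit_shift[OF assms, of 0 l] qlife_shift[OF assms, of 0] zeta_nonneg[OF assms]
  by (simp add: hit_functional_def tau_def indicator_def zero_ereal_def[symmetric])

text \<open>Passage at \<open>b\<close> takes the time to reach \<open>a\<close> plus the passage
  time \<open>h\<close> of the shifted path: the exponentials multiply, and \<open>h\<close> lies
  before the residual lifetime exactly if \<open>tau b \<omega>\<close> lies before
  \<open>\<zeta> \<omega>\<close>.\<close>

lemma hit_functional_shift:
  assumes w: "\<omega> \<in> \<Omega>" and "b < a" "tau a \<omega> < \<zeta> \<omega>"
  shows "hit_functional q b (shift X (real_of_ereal (tau a \<omega>)) \<omega>) * disc q (tau a \<omega>)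
    = disc q (tau b \<omega>) * indicator {\<omega>. tau b \<omega> < \<zeta> \<omega>} \<omega>"
proof -
  obtain s where s: "tau a \<omega> = ereal s" using assms(3) tau_nonneg[of a \<omega>] by (cases "tau a \<omega>") auto
  have s0: "0 \<le> s" using tau_nonneg[of a \<omega>] s by simp
  define h where "h = hit (\<lambda>t. X (s + t) \<omega>) b"
  have h: "qhit (shift X s \<omega>) b = h" unfolding h_def by (rule qhit_shift[OF w s0])
  have life: "qlife (shift X s \<omega>) = \<zeta> \<omega> - ereal s"
    using assms(3) s by (intro qlife_shift[OF w s0]) simp
  have split: "tau b \<omega> = ereal s + h"
    using hit_split[OF path_rc[OF w] assms(2), of s] s by (simp add: tau_def h_def)
  have "0 \<le> h" by (simp add: h_def hit_nonneg)
  then show ?thesis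
    unfolding hit_functional_def indicator_def mem_Collect_eq s real_of_ereal.simps h life split
    using assms(3) s
    by (cases h; cases "\<zeta> \<omega>")
      (auto simp: indicator_def disc_def ennreal_mult[symmetric] exp_add[symmetric] algebra_simps)
qed

text \<open>The left-hand side of (S), written with the stopping time \<open>tau l\<close> instead
  of \<open>Tminus X \<zeta> l\<close>.\<close>

definition K :: "real \<Rightarrow> real \<Rightarrow> real \<Rightarrow> ennreal" where
  "K q x l = (\<integral>\<^sup>+\<omega>. disc q (tau l \<omega>) * indicator {\<omega>. tau l \<omega> < \<zeta> \<omega>} \<omega> \<partial>P x)"

lemma nn_integral_hit_functional:
  "y \<in> I \<Longrightarrow> (\<integral>\<^sup>+\<omega>. hit_functional q l (shift X 0 \<omega>) \<partial>P y) = K q y l"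
  unfolding K_def by (intro nn_integral_cong) (simp add: hit_functional_start space_P)

lemma tau_le_Tminus:
  shows "tau l \<omega> \<le> Tminus X \<zeta> l \<omega>"
  unfolding Tminus_def tau_def
  by (rule Inf_greatest) (auto intro: hit_le_of_value[where w = "\<lambda>t. X t \<omega>"])

lemma Tminus_eq_tau:
  assumes "tau l \<omega> < \<zeta> \<omega>" "at_time X (tau l) \<omega> \<le> ereal l"
  shows "Tminus X \<zeta> l \<omega> = tau l \<omega>"
proof (rule antisym[OF _ tau_le_Tminus])
  obtain s where s: "tau l \<omega> = ereal s" using assms(1) tau_nonneg[of l \<omega>] by (cases "tau l \<omega>") auto
  then show "Tminus X \<zeta> l \<omega> \<le> tau l \<omega>"
    unfolding Tminus_def using assms tau_nonneg[of l \<omega>]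
    by (intro Inf_lower) (auto simp: at_time_def)
qed

lemma Tminus_less_zeta_iff:
  "Tminus X \<zeta> l \<omega> < \<zeta> \<omega> \<longleftrightarrow> (\<exists>t. 0 \<le> t \<and> ereal t < \<zeta> \<omega> \<and> X t \<omega> \<le> ereal l)"
  unfolding Tminus_def Inf_less_iff by auto

lemma Tminus_infinite:
  assumes "\<not> Tminus X \<zeta> l \<omega> < \<zeta> \<omega>"
  shows "Tminus X \<zeta> l \<omega> = \<infinity>"
proof -
  have "{ereal t | t. 0 \<le> t \<and> ereal t < \<zeta> \<omega> \<and> X t \<omega> \<le> ereal l} = {}"
    using assms unfolding Tminus_less_zeta_iff by auto
  then show ?thesis unfolding Tminus_def by (simp only: Inf_empty top_ereal_def)
qed

text \<open>The filtration need not be right-continuous, so it is \<open>tau l\<close>, the first time at which the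
  running infimum is at most \<open>l\<close>, that is visibly a stopping time. The two times can differ only if
  the left limit reaches \<open>l\<close> at \<open>tau l\<close> while the path jumps away or dies there. Since
  \<open>tau (l + 1 / n)\<close> announces \<open>tau l\<close> in that event, quasi left-continuity excludes the jump and
  non-announceability the death.\<close>
lemma AE_Tminus_eq_tau:
  assumes x: "x \<in> I"
  shows "AE \<omega> in P x. Tminus X \<zeta> l \<omega> = tau l \<omega> \<and> (tau l \<omega> < \<zeta> \<omega> \<longrightarrow> at_time X (tau l) \<omega> \<le> ereal l)"
proof -
  let ?T = "\<lambda>n. tau (l + 1 / real (Suc n))"
  have inc: "incseq (\<lambda>n. ?T n \<omega>)" and lim: "(\<lambda>n. ?T n \<omega>) \<longlonglongrightarrow> tau l \<omega>" if "\<omega> \<in> \<Omega>" for \<omega>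
    using hit_tendsto[OF path_rc[OF that], of l] by (simp_all add: tau_def)
  have AEinc: "AE \<omega> in P y. incseq (\<lambda>n. ?T n \<omega>) \<and> (\<lambda>n. ?T n \<omega>) \<longlonglongrightarrow> tau l \<omega>" if "y \<in> I" for y
    by (rule AE_I2) (use inc lim space_P[OF that] in auto)
  have "AE \<omega> in P x. tau l \<omega> < \<zeta> \<omega> \<longrightarrow> (\<lambda>n. at_time X (?T n) \<omega>) \<longlonglongrightarrow> at_time X (tau l) \<omega>"
    by (rule quasi_left_continuity[OF tau_fstop tau_fstop AEinc x])
  moreover have "AE \<omega> in P x. \<not> ((\<forall>n. ?T n \<omega> < \<zeta> \<omega>) \<and> (\<lambda>n. ?T n \<omega>) \<longlonglongrightarrow> \<zeta> \<omega> \<and>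
                                   \<zeta> \<omega> < \<infinity> \<and> zeta_minus I X \<zeta> \<omega> < \<infinity>)"
    by (rule non_announceability[OF tau_fstop _ x]) (use AEinc in fastforce)
  moreover have "AE \<omega> in P x. \<omega> \<in> \<Omega>" by (rule AE_I2) (simp add: space_P[OF x])
  ultimately show ?thesis
    using zeta_pos[OF x] lifetime_left_limit[OF x]
  proof eventually_elim
    case (elim \<omega>)
    note w = \<open>\<omega> \<in> \<Omega>\<close>
    note rcw = path_rc[OF w]
    let ?w = "\<lambda>t. X t \<omega>"
    have inf_le: "rinf ?w s \<le> ereal l" if "tau l \<omega> \<le> ereal s" "0 \<le> s" for s
      using hit_le_iff[OF rcw that(2)] that(1) by (simp add: tau_def)
    have early: "?T n \<omega> < ereal s" if app: "\<And>d. ereal l < d \<Longrightarrow> \<exists>r\<ge>0. r < s \<and> ?w r < d" for n s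
    proof -
      obtain r where r: "0 \<le> r" "r < s" "?w r < ereal (l + 1 / real (Suc n))" 
        using app[of "ereal (l + 1 / real (Suc n))"] by auto
      then have "?T n \<omega> \<le> ereal r" unfolding tau_def by (intro hit_le_of_value) auto
      then show ?thesis using r(2) by (simp add: le_less_trans)
    qed
    show ?case
    proof (cases "tau l \<omega> < \<zeta> \<omega>")
      case True
      then obtain s where s: "tau l \<omega> = ereal s" using tau_nonneg[of l \<omega>] by (cases "tau l \<omega>") auto
      have s0: "0 \<le> s" using tau_nonneg[of l \<omega>] s by simp
      have "?w s \<le> ereal l"
      proof (rule ccontr)
        assume c: "\<not> ?w s \<le> ereal l"
        have "s \<noteq> 0"
        proof
          assume "s = 0"
          then have "rinf ?w s = ?w s" by (simp add: rinf_def)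
          then show False using c inf_le[of s] s s0 by simp
        qed
        then have "0 < s" using s0 by simp
        \<comment> \<open>Otherwise every value up to \<open>s\<close> is at least
          \<open>min d (?w s)\<close>, which exceeds \<open>l\<close>, against
          \<open>inf_le\<close>.\<close>
        have approach: "\<exists>r\<ge>0. r < s \<and> ?w r < d" if d: "ereal l < d" for d
        proof (rule ccontr)
          assume nex: "\<not> ?thesis"
          have "min d (?w s) \<le> rinf ?w s"
          proof (rule rinf_ge)
            fix r assume r: "0 \<le> r" "r \<le> s"
            show "min d (?w s) \<le> ?w r"
              using nex r by (cases "r = s") (auto simp: min_le_iff_disj not_less)
          qed
          then show False using inf_le[of s] s s0 c d by (auto simp: min_le_iff_disj)
        qed
        obtain L where L: "(?w \<longlongrightarrow> ereal L) (at_left s)" using cadlag(3)[OF w s0] True s \<open>0 < s\<close> by auto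
        have lt: "?T n \<omega> < ereal s" for n using early[OF approach] .
        \<comment> \<open>The announcing times tend to \<open>s\<close> from strictly below, so the
          values there tend to the left limit; by quasi left-continuity they also tend to
          \<open>?w s\<close>. Hence there is no jump at \<open>s\<close>.\<close>
        have "(\<lambda>n. real_of_ereal (?T n \<omega>)) \<longlonglongrightarrow> s"
          using lim_real_of_ereal[of "\<lambda>n. ?T n \<omega>" s] lim[OF w] s by simp
        moreover have "real_of_ereal (?T n \<omega>) < s" for n
          using lt[of n] tau_nonneg[of "l + 1 / real (Suc n)" \<omega>] by (cases "?T n \<omega>") auto
        ultimately have "filterlim (\<lambda>n. real_of_ereal (?T n \<omega>)) (at_left s) sequentially"
          unfolding filterlim_at using less_imp_neq by (auto intro!: always_eventually)
        from filterlim_compose[OF L this] have "(\<lambda>n. at_time X (?T n) \<omega>) \<longlonglongrightarrow> ereal L"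
          by (simp add: at_time_def)
        moreover have "(\<lambda>n. at_time X (?T n) \<omega>) \<longlonglongrightarrow> ?w s"
          using elim(1) True s by (simp add: at_time_def)
        ultimately have "ereal L = ?w s" by (rule LIMSEQ_unique)
        then have "ereal l < ereal L" using c by simp
        from left_limit_gt[OF L \<open>0 < s\<close> this] obtain d where
          "ereal l < d" "\<And>r. 0 \<le> r \<Longrightarrow> r < s \<Longrightarrow> d \<le> ?w r"
          using before_hit_rinf[of _ ?w l] s by (auto simp: tau_def)
        with approach[of d] show False by (auto simp: not_less[symmetric])
      qed
      then have "at_time X (tau l) \<omega> \<le> ereal l" using s by (simp add: at_time_def)
      with Tminus_eq_tau[OF True] show ?thesis by simp
    next
      case False
      then have nT: "\<not> Tminus X \<zeta> l \<omega> < \<zeta> \<omega>" using tau_le_Tminus[of l \<omega>] by (meson le_less_trans)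
      have "tau l \<omega> = \<infinity>"
      proof (rule ccontr)
        assume "tau l \<omega> \<noteq> \<infinity>"
        then obtain s where s: "tau l \<omega> = ereal s" using tau_nonneg[of l \<omega>] by (cases "tau l \<omega>") auto
        have s0: "0 \<le> s" using tau_nonneg[of l \<omega>] s by simp
        obtain z where z: "\<zeta> \<omega> = ereal z" "0 < z" "z \<le> s"
          using False s elim(4) by (cases "\<zeta> \<omega>") auto
        \<comment> \<open>From the lifetime on the path equals \<open>\<infinity>\<close>, so an
          infimum at most \<open>l\<close> must stem from before \<open>z\<close>.\<close>
        have approach: "\<exists>r\<ge>0. r < z \<and> ?w r < d" if d: "ereal l < d" for d
        proof (rule ccontr)
          assume nex: "\<not> ?thesis"
          have "d \<le> rinf ?w s"
          proof (rule rinf_ge)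
            fix r assume r: "0 \<le> r" "r \<le> s"
            show "d \<le> ?w r"
            proof (cases "r < z")
              case True then show ?thesis using nex r by (auto simp: not_less)
            next
              case False then show ?thesis using cemetery[OF w r(1)] z by simp
            qed
          qed
          then show False using inf_le[of s] s s0 d by (simp add: leD le_less_trans)
        qed
        obtain L where L: "(?w \<longlongrightarrow> L) (at_left z)" "L \<in> ereal ` I \<or> L = \<infinity>"
          using elim(5) z by auto
        \<comment> \<open>With this the left limit at the lifetime is finite, so that
          non-announceability applies.\<close>
        have "\<not> ereal l < L"
        proof
          assume "ereal l < L"
          from left_limit_gt[OF L(1) z(2) this] obtain d where
            "ereal l < d" "\<And>r. 0 \<le> r \<Longrightarrow> r < z \<Longrightarrow> d \<le> ?w r"
            using before_hit_rinf[of _ ?w l] s z by (auto simp: tau_def)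
          with approach[of d] show False by (auto simp: not_less[symmetric])
        qed
        then have "L < \<infinity>" by auto
        have "zeta_minus I X \<zeta> \<omega> = Lim (at_left z) ?w"
          using L z unfolding zeta_minus_def by auto
        also have "\<dots> = L" using L(1) by (intro tendsto_Lim) (auto simp: trivial_limit_at_left_real)
        finally have "zeta_minus I X \<zeta> \<omega> < \<infinity>" using \<open>L < \<infinity>\<close> by simp
        moreover have lt: "?T n \<omega> < \<zeta> \<omega>" for n using early[OF approach] z(1) by simp
        \<comment> \<open>The announcing times lie below the lifetime, hence their limit does not
          exceed it; the case assumption supplies the converse inequality.\<close>
        moreover have "tau l \<omega> = \<zeta> \<omega>"
          using LIMSEQ_le_const2[OF lim[OF w], of "\<zeta> \<omega>"] lt False by (auto intro: less_imp_le antisym)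
        ultimately show False using elim(2) lim[OF w] z(1) by auto
      qed
      then show ?thesis using Tminus_infinite[OF nT] False by simp
    qed
  qed
qed

section \<open>Jumps, running infimum and continuity at the minimum\<close>

lemma AE_in_space: "x \<in> I \<Longrightarrow> AE \<omega> in P x. \<omega> \<in> \<Omega>"
  by (rule AE_I2) (simp add: space_P)

lemma run_inf_eq: "run_inf X t \<omega> = rinf (\<lambda>s. X s \<omega>) t"
  by (simp add: run_inf_def rinf_def)

lemma no_neg_jumps_imp_run_inf_continuous:
  assumes "no_neg_jumps I P X \<zeta>"
  shows "run_inf_continuous I P X \<zeta>"
  unfolding run_inf_continuous_def
proof
  fix x assume x: "x \<in> I"
  have "AE \<omega> in P x. \<forall>t. 0 < t \<and> ereal t < \<zeta> \<omega> \<longrightarrow> left_lim X t \<omega> \<le> X t \<omega>"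
    using assms x unfolding no_neg_jumps_def by blast
  then show "AE \<omega> in P x. continuous_on {t. 0 \<le> t \<and> ereal t < \<zeta> \<omega>} (\<lambda>t. run_inf X t \<omega>)"
    using AE_in_space[OF x]
  proof eventually_elim
    case (elim \<omega>)
    have "\<exists>L. ((\<lambda>s. X s \<omega>) \<longlongrightarrow> L) (at_left t) \<and> L \<le> X t \<omega>" if t: "0 < t" "ereal t < \<zeta> \<omega>" for t
    proof -
      obtain l where l: "((\<lambda>s. X s \<omega>) \<longlongrightarrow> ereal l) (at_left t)"
        using cadlag(3)[OF elim(2), of t] t by auto
      then have "left_lim X t \<omega> = ereal l"
        unfolding left_lim_def by (intro tendsto_Lim) (auto simp: trivial_limit_at_left_real)
      then show ?thesis using l elim(1) t by metis
    qed
    then show ?case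
      unfolding run_inf_eq by (intro rinf_continuous_on path_rc elim(2))
  qed
qed

text \<open>If the value exceeded \<open>a\<close>, right-continuity would keep the path above
  \<open>a\<close> for a while and the infimum would be later. Unlike its analogue for
  \<open>tau\<close>, this holds for every \<open>\<omega>\<close> in
  \<open>\<Omega>\<close>.\<close>

lemma at_Tminus_le:
  assumes w: "\<omega> \<in> \<Omega>" and lt: "Tminus X \<zeta> a \<omega> < \<zeta> \<omega>"
  shows "at_time X (Tminus X \<zeta> a) \<omega> \<le> ereal a"
proof (rule ccontr)
  assume c: "\<not> ?thesis"
  have nonneg: "0 \<le> Tminus X \<zeta> a \<omega>" using tau_le_Tminus[of a \<omega>] tau_nonneg[of a \<omega>] by (rule order_trans[rotated])
  obtain s where s: "Tminus X \<zeta> a \<omega> = ereal s" "0 \<le> s"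
    using lt nonneg by (cases "Tminus X \<zeta> a \<omega>") auto
  then have "ereal a < X s \<omega>" using c by (simp add: at_time_def)
  then obtain e where e: "e > 0" "\<And>r. s \<le> r \<Longrightarrow> r < s + e \<Longrightarrow> ereal a < X r \<omega>"
    using rc_gt_nbhd[OF path_rc[OF w] s(2)] by blast
  have "ereal (s + e) \<le> Tminus X \<zeta> a \<omega>"
    unfolding Tminus_def
  proof (rule Inf_greatest, clarify)
    fix t assume t: "0 \<le> t" "ereal t < \<zeta> \<omega>" "X t \<omega> \<le> ereal a"
    have "Tminus X \<zeta> a \<omega> \<le> ereal t" unfolding Tminus_def using t by (intro Inf_lower) auto
    then have "s \<le> t" using s by simp
    then show "ereal (s + e) \<le> ereal t" using e(2)[of t] t(3) by (cases "t < s + e") auto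
  qed
  then show False using s e(1) by simp
qed

text \<open>Before the passage time the running infimum is at least \<open>a\<close>; continuity
  carries this bound to the passage time, where the infimum lies below the value of the
  path.\<close>

lemma run_inf_continuous_imp_cont_at_min:
  assumes "run_inf_continuous I P X \<zeta>"
  shows "cont_at_min I P X \<zeta>"
  unfolding cont_at_min_def
proof (intro ballI impI)
  fix x a assume x: "x \<in> I" and a: "a \<in> I" "a \<le> x \<and> (\<exists>b\<in>I. b < a)"
  have "AE \<omega> in P x. continuous_on {t. 0 \<le> t \<and> ereal t < \<zeta> \<omega>} (\<lambda>t. run_inf X t \<omega>)"
    using assms x unfolding run_inf_continuous_def by blast
  then show "AE \<omega> in P x. Tminus X \<zeta> a \<omega> < \<zeta> \<omega> \<longrightarrow> at_time X (Tminus X \<zeta> a) \<omega> = ereal a"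
    using AE_in_space[OF x] normality[OF x]
  proof eventually_elim
    case (elim \<omega>)
    let ?w = "\<lambda>t. X t \<omega>"
    show ?case
    proof
      assume lt: "Tminus X \<zeta> a \<omega> < \<zeta> \<omega>"
      have nonneg: "0 \<le> Tminus X \<zeta> a \<omega>" using tau_le_Tminus[of a \<omega>] tau_nonneg[of a \<omega>] by (rule order_trans[rotated])
      obtain s where s: "Tminus X \<zeta> a \<omega> = ereal s" "0 \<le> s"
        using lt nonneg by (cases "Tminus X \<zeta> a \<omega>") auto
      have le: "?w s \<le> ereal a" using at_Tminus_le[OF elim(2) lt] s by (simp add: at_time_def)
      have "ereal a \<le> ?w s"
      proof (cases "s = 0")
        case True
        then show ?thesis using elim(3) a by simp
      next
        case False
        then have "0 < s" using s by simp
        have before: "ereal a \<le> rinf ?w r" if r: "0 \<le> r" "r < s" for r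
        proof (rule rinf_ge, rule ccontr)
          fix t assume t: "0 \<le> t" "t \<le> r" "\<not> ereal a \<le> ?w t"
          then have "ereal t < ereal s" using r by simp
          also have "\<dots> < \<zeta> \<omega>" using lt s by simp
          finally have "Tminus X \<zeta> a \<omega> \<le> ereal t"
            unfolding Tminus_def using t by (intro Inf_lower) auto
          then show False using s t r by simp
        qed
        let ?D = "{t. 0 \<le> t \<and> ereal t < \<zeta> \<omega>}"
        have "(rinf ?w \<longlongrightarrow> rinf ?w s) (at s within ?D)"
          using elim(1) lt s unfolding continuous_on_def run_inf_eq by simp
        moreover have "{0..<s} \<subseteq> ?D" using lt s by (auto intro: less_trans[of _ "ereal s"])
        ultimately have "(rinf ?w \<longlongrightarrow> rinf ?w s) (at s within {0..<s})"
          using tendsto_within_subset by blast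
        moreover have "at s within {0..<s} \<noteq> bot"
        proof -
          have "at s within {0..<s} = at_left s"
            by (rule at_within_nhd[of _ "{0<..}"]) (use \<open>0 < s\<close> in auto)
          then show ?thesis by (simp add: trivial_limit_at_left_real)
        qed
        moreover have "\<forall>\<^sub>F r in at s within {0..<s}. ereal a \<le> rinf ?w r"
          unfolding eventually_at_filter using before by (auto intro: always_eventually)
        ultimately have "ereal a \<le> rinf ?w s" by (intro tendsto_lowerbound)
        also have "\<dots> \<le> ?w s" using s by (intro rinf_le) auto
        finally show ?thesis .
      qed
      with le show "at_time X (Tminus X \<zeta> a) \<omega> = ereal a" using s by (simp add: at_time_def)
    qed
  qed
qed

lemma cont_at_min_AE_no_overshoot:
  assumes v: "cont_at_min I P X \<zeta>" and y: "y \<in> I" "a \<le> y" and "b < a"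
  shows "AE \<omega> in P y. \<not> (tau a \<omega> = tau b \<omega> \<and> tau b \<omega> < \<zeta> \<omega>)"
proof -
  have at_hit: "at_time X (tau a) \<omega> \<in> ereal ` I" "at_time X (tau a) \<omega> \<le> ereal b"
    if w: "\<omega> \<in> \<Omega>" and eq: "tau a \<omega> = tau b \<omega>" and lt: "tau b \<omega> < \<zeta> \<omega>" for \<omega>
  proof -
    obtain s where s: "tau b \<omega> = ereal s" using lt tau_nonneg[of b \<omega>] by (cases "tau b \<omega>") auto
    have "0 \<le> s" using tau_nonneg[of b \<omega>] s by simp
    then show "at_time X (tau a) \<omega> \<in> ereal ` I" using cadlag(1)[OF w, of s] eq lt s by (simp add: at_time_def)
    show "at_time X (tau a) \<omega> \<le> ereal b"
      using hit_eq_value_le[OF path_rc[OF w] \<open>b < a\<close>, of s] eq s by (simp add: at_time_def tau_def)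
  qed
  show ?thesis
  proof (cases "\<exists>c\<in>I. c < a")
    case True
    then have "a \<in> I" using interval_I y by (metis less_imp_le mem_is_interval_1_I)
    then have "AE \<omega> in P y. Tminus X \<zeta> a \<omega> < \<zeta> \<omega> \<longrightarrow> at_time X (Tminus X \<zeta> a) \<omega> = ereal a"
      using v y True unfolding cont_at_min_def by blast
    then show ?thesis
      using AE_in_space[OF y(1)]
    proof eventually_elim
      case (elim \<omega>)
      show ?case
      proof
        assume h: "tau a \<omega> = tau b \<omega> \<and> tau b \<omega> < \<zeta> \<omega>"
        then have le: "at_time X (tau a) \<omega> \<le> ereal b" using at_hit elim by blast
        have lt: "ereal b < ereal a" using \<open>b < a\<close> by simp
        then have "Tminus X \<zeta> a \<omega> = tau a \<omega>" using h order_trans[OF le less_imp_le[OF lt]] by (intro Tminus_eq_tau) auto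
        then have "at_time X (tau a) \<omega> = ereal a" using elim(1) h by (simp add: at_time_def)
        with le lt show False by simp
      qed
    qed
  next
    \<comment> \<open>The definition of \<open>cont_at_min\<close> is silent about such
      \<open>a\<close>, but then no state lies below \<open>a\<close>, so the path cannot be at a
      point of \<open>{..b}\<close>.\<close>
    case False
    show ?thesis
      using AE_in_space[OF y(1)]
    proof eventually_elim
      case (elim \<omega>)
      show ?case
      proof
        assume "tau a \<omega> = tau b \<omega> \<and> tau b \<omega> < \<zeta> \<omega>"
        with at_hit[OF elim] obtain c where "c \<in> I" "c \<le> b" by auto
        with False \<open>b < a\<close> show False by auto
      qed
    qed
  qed
qed

lemma cont_at_min_imp_no_neg_jumps:
  assumes v: "cont_at_min I P X \<zeta>"
  shows "no_neg_jumps I P X \<zeta>"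
  unfolding no_neg_jumps_def
proof
  fix x assume x: "x \<in> I"
  \<comment> \<open>The event that the path restarted at time \<open>s\<close> overshoots from
    \<open>a\<close> to below \<open>b\<close>. It is null for fixed parameters, and rational
    parameters suffice to catch every negative jump.\<close>
  have AE_sab: "AE \<omega> in P x. \<not> (ereal s < \<zeta> \<omega> \<and> ereal a \<le> X s \<omega> \<and>
      hit (\<lambda>t. X (s + t) \<omega>) a = hit (\<lambda>t. X (s + t) \<omega>) b \<and> hit (\<lambda>t. X (s + t) \<omega>) b < \<zeta> \<omega> - ereal s)"
    if s: "0 \<le> s" and "b < a" for s a b :: real
  proof -
    define H :: "(real \<Rightarrow> ereal) \<Rightarrow> ennreal" where
      "H w = (if qhit w a = qhit w b \<and> qhit w b < qlife w then 1 else 0)" for w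
    have [measurable]: "Measurable.pred path_meas (\<lambda>w. qhit w a = qhit w b)"
      "Measurable.pred path_meas (\<lambda>w. qhit w b < qlife w)"
      unfolding Measurable.pred_def
      by (rule borel_measurable_eq borel_measurable_less; rule qhit_measurable qlife_measurable)+
    have H [measurable]: "H \<in> borel_measurable path_meas" unfolding H_def[abs_def] by measurable
    define S :: "'a \<Rightarrow> ereal" where "S = (\<lambda>_. ereal s)"
    \<comment> \<open>The overshoot lemma governs starting points \<open>y \<ge> a\<close> only, so
      the restart is restricted to \<open>X s \<ge> a\<close>, an event of
      \<open>F s\<close>.\<close>
    define A where "A = {\<omega>\<in>\<Omega>. X s \<omega> \<in> {ereal a..}}"
    have ctd: "{\<omega>\<in>\<Omega>. ereal s \<le> ereal t} \<in> F t" if t: "0 \<le> t" for t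
    proof -
      interpret sigma_algebra \<Omega> "F t" by (rule F_sigma[OF t])
      show ?thesis by (cases "s \<le> t") auto
    qed
    have S: "fstop \<Omega> F S"
      using ctd s by (simp add: fstop_def S_def)
    have AF: "A \<in> F s" unfolding A_def by (rule adapted[OF s]) simp
    have A: "A \<in> pre_stop \<Omega> F S"
      unfolding pre_stop_def
    proof (intro CollectI conjI allI impI)
      show "A \<in> Finf \<Omega> F" by (rule F_Finf[OF s AF])
      fix t :: real assume t: "0 \<le> t"
      show "A \<inter> {\<omega>\<in>\<Omega>. S \<omega> \<le> ereal t} \<in> F t"
      proof (cases "s \<le> t")
        case True
        then have "A \<inter> {\<omega>\<in>\<Omega>. S \<omega> \<le> ereal t} = A" by (auto simp: A_def S_def)
        then show ?thesis using AF F_mono[OF s True] by auto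
      next
        case False
        then have "A \<inter> {\<omega>\<in>\<Omega>. S \<omega> \<le> ereal t} = {}" by (auto simp: S_def)
        then show ?thesis using sigma_algebra_iff2[THEN iffD1, OF F_sigma[OF t]] by simp
      qed
    qed
    have inner: "(\<integral>\<^sup>+\<omega>'. H (shift X 0 \<omega>') \<partial>P y) = 0" if y: "y \<in> I" "a \<le> y" for y
    proof -
      have "AE \<omega>' in P y. H (shift X 0 \<omega>') = 0"
        using cont_at_min_AE_no_overshoot[OF v y \<open>b < a\<close>] AE_in_space[OF y(1)]
      proof eventually_elim
        case (elim \<omega>)
        then show ?case
          using qhit_shift[OF elim(2), of 0] qlife_shift[OF elim(2), of 0] zeta_nonneg[OF elim(2)]
          by (simp add: H_def tau_def zero_ereal_def[symmetric])
      qed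
      then have "(\<integral>\<^sup>+\<omega>'. H (shift X 0 \<omega>') \<partial>P y) = (\<integral>\<^sup>+\<omega>'. 0 \<partial>P y)" by (rule nn_integral_cong_AE)
      then show ?thesis by simp
    qed
    have "(\<integral>\<^sup>+\<omega>. H (shift X (real_of_ereal (S \<omega>)) \<omega>) * indicator (A \<inter> {\<omega>. S \<omega> < \<zeta> \<omega>}) \<omega> \<partial>P x)
      = (\<integral>\<^sup>+\<omega>. (\<integral>\<^sup>+\<omega>'. H (shift X 0 \<omega>') \<partial>P (real_of_ereal (at_time X S \<omega>)))
                 * indicator (A \<inter> {\<omega>. S \<omega> < \<zeta> \<omega>}) \<omega> \<partial>P x)"
      by (rule strong_markov[OF S H A x])
    also have "\<dots> = (\<integral>\<^sup>+\<omega>. 0 \<partial>P x)"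
    proof (rule nn_integral_cong)
      fix \<omega> assume "\<omega> \<in> space (P x)"
      then have w: "\<omega> \<in> \<Omega>" using space_P[OF x] by simp
      show "(\<integral>\<^sup>+\<omega>'. H (shift X 0 \<omega>') \<partial>P (real_of_ereal (at_time X S \<omega>)))
                 * indicator (A \<inter> {\<omega>. S \<omega> < \<zeta> \<omega>}) \<omega> = 0"
      proof (cases "\<omega> \<in> A \<and> ereal s < \<zeta> \<omega>")
        case True
        then obtain y where y: "y \<in> I" "X s \<omega> = ereal y" using cadlag(1)[OF w s] by auto
        then have "a \<le> y" using True by (simp add: A_def)
        then show ?thesis using inner[OF y(1)] y by (simp add: at_time_def S_def)
      qed (auto simp: S_def)
    qed
    finally have "(\<integral>\<^sup>+\<omega>. H (shift X s \<omega>) * indicator (A \<inter> {\<omega>. ereal s < \<zeta> \<omega>}) \<omega> \<partial>P x) = 0"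
      by (simp add: S_def)
    moreover have "(\<lambda>\<omega>. H (shift X s \<omega>) * indicator (A \<inter> {\<omega>. ereal s < \<zeta> \<omega>}) \<omega>) \<in> borel_measurable (P x)"
    proof -
      have [measurable]: "(\<lambda>\<omega>. H (shift X s \<omega>)) \<in> borel_measurable (P x)"
        using stop_shift_measurable[OF S x H] by (simp add: S_def)
      have [measurable]: "(\<lambda>\<omega>. indicator {\<omega>. ereal s < \<zeta> \<omega>} \<omega> :: ennreal) \<in> borel_measurable (P x)"
        using alive_indicator_measurable[OF S x] by (simp add: S_def)
      have [measurable]: "A \<in> sets (P x)" by (rule F_sets_P[OF x s AF])
      have "(\<lambda>\<omega>. H (shift X s \<omega>) * (indicator A \<omega> * indicator {\<omega>. ereal s < \<zeta> \<omega>} \<omega>)) \<in> borel_measurable (P x)"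
        by measurable
      then show ?thesis by (simp add: indicator_inter_arith)
    qed
    ultimately have "AE \<omega> in P x. H (shift X s \<omega>) * indicator (A \<inter> {\<omega>. ereal s < \<zeta> \<omega>}) \<omega> = 0"
      by (simp add: nn_integral_0_iff_AE)
    then show ?thesis
      using AE_in_space[OF x]
    proof eventually_elim
      case (elim \<omega>)
      show ?case
      proof (intro notI, elim conjE)
        assume h: "ereal s < \<zeta> \<omega>" "ereal a \<le> X s \<omega>"
          "hit (\<lambda>t. X (s + t) \<omega>) a = hit (\<lambda>t. X (s + t) \<omega>) b" "hit (\<lambda>t. X (s + t) \<omega>) b < \<zeta> \<omega> - ereal s"
        have "H (shift X s \<omega>) = 1"
          using qhit_shift[OF elim(2) s] qlife_shift[OF elim(2) s] h by (simp add: H_def)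
        moreover have "\<omega> \<in> A \<inter> {\<omega>. ereal s < \<zeta> \<omega>}" using elim(2) h by (simp add: A_def)
        ultimately show False using elim(1) by simp
      qed
    qed
  qed
  have "AE \<omega> in P x. \<forall>s\<in>\<rat> \<inter> {0..}. \<forall>a\<in>\<rat>. \<forall>b\<in>\<rat> \<inter> {..<a}. \<not> (ereal s < \<zeta> \<omega> \<and> ereal a \<le> X s \<omega> \<and>
      hit (\<lambda>t. X (s + t) \<omega>) a = hit (\<lambda>t. X (s + t) \<omega>) b \<and> hit (\<lambda>t. X (s + t) \<omega>) b < \<zeta> \<omega> - ereal s)"
    by (intro AE_ball_countable[THEN iffD2] ballI countable_Int1 countable_rat AE_sab) auto
  then show "AE \<omega> in P x. \<forall>t. 0 < t \<and> ereal t < \<zeta> \<omega> \<longrightarrow> left_lim X t \<omega> \<le> X t \<omega>"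
    using AE_in_space[OF x]
  proof eventually_elim
    case (elim \<omega>)
    show ?case
    proof (intro allI impI, rule ccontr)
      fix t assume t: "0 < t \<and> ereal t < \<zeta> \<omega>" and neg: "\<not> left_lim X t \<omega> \<le> X t \<omega>"
      obtain L where L: "((\<lambda>s. X s \<omega>) \<longlongrightarrow> ereal L) (at_left t)"
        using cadlag(3)[OF elim(2), of t] t by auto
      then have "left_lim X t \<omega> = ereal L"
        unfolding left_lim_def by (intro tendsto_Lim) (auto simp: trivial_limit_at_left_real)
      moreover obtain z where z: "X t \<omega> = ereal z" using cadlag(1)[OF elim(2), of t] t by auto
      ultimately have "z < L" using neg by simp
      then obtain b where b: "b \<in> \<rat>" "z < b" "b < L" using Rats_dense_in_real by blast
      obtain a where a: "a \<in> \<rat>" "b < a" "a < L" using Rats_dense_in_real[OF b(3)] by blast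
      \<comment> \<open>Values above \<open>a'\<close> have an infimum at least
        \<open>a' > a\<close>, so passage at \<open>a\<close> cannot occur before the jump; working
        with \<open>a\<close> alone would leave room for equality.\<close>
      obtain a' where a': "a < a'" "a' < L" using dense[OF a(3)] by blast
      have "ereal a' < ereal L" using a' by simp
      then obtain r where r: "r < t" "\<And>u. r < u \<Longrightarrow> u < t \<Longrightarrow> ereal a' < X u \<omega>"
        using order_tendstoD(1)[OF L] unfolding eventually_at_left_field by blast
      \<comment> \<open>Restarting this close to \<open>t\<close> forgets any earlier, lower values
        of the path.\<close>
      obtain s where s: "s \<in> \<rat>" "max 0 r < s" "s < t" using Rats_dense_in_real[of "max 0 r" t] r t by auto
      let ?v = "\<lambda>t. X (s + t) \<omega>"
      have hb: "hit ?v b \<le> ereal (t - s)"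
        using s z b by (intro hit_le_of_value) auto
      have ha: "ereal (t - s) \<le> hit ?v a"
      proof (rule ccontr)
        assume "\<not> ?thesis"
        then obtain u where u: "0 \<le> u" "u < t - s" "rinf ?v u \<le> ereal a"
          unfolding hit_def not_le Inf_less_iff by auto
        have "ereal a' \<le> rinf ?v u"
          by (rule rinf_ge, rule less_imp_le, rule r(2)) (use u s in auto)
        then have "ereal a' \<le> ereal a" using u(3) by (rule order_trans)
        then show False using a' by simp
      qed
      have "hit ?v a \<le> hit ?v b" using a by (intro hit_antimono) simp
      then have eq: "hit ?v a = ereal (t - s)" "hit ?v b = ereal (t - s)" using ha hb by auto
      have "ereal s < \<zeta> \<omega>" using s t by (auto intro: less_trans[of _ "ereal t"])
      moreover have "ereal a \<le> X s \<omega>"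
        using r(2)[of s] s a' by (auto intro: order_trans[of _ "ereal a'"])
      moreover have "hit ?v b < \<zeta> \<omega> - ereal s"
        using eq t by (cases "\<zeta> \<omega>") auto
      ultimately show False
        using elim(1)[rule_format, of s a b] a(1,2) b(1) s(1,2) eq by auto
    qed
  qed
qed

section \<open>Laplace transforms of passage times\<close>

lemma integrand_measurable:
  "x \<in> I \<Longrightarrow> (\<lambda>\<omega>. disc q (tau l \<omega>) * indicator {\<omega>. tau l \<omega> < \<zeta> \<omega>} \<omega>) \<in> borel_measurable (P x)"
  using fstop_measurable[OF tau_fstop] alive_indicator_measurable[OF tau_fstop]
  by (intro borel_measurable_times_ennreal measurable_compose[OF _ disc_measurable]) auto

lemma K_le_1:
  assumes "x \<in> I" "0 \<le> q"
  shows "K q x l \<le> 1"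
proof -
  interpret prob_space "P x" using prob_P[OF assms(1)] .
  have "K q x l \<le> (\<integral>\<^sup>+\<omega>. 1 \<partial>P x)"
    unfolding K_def
    by (rule nn_integral_mono) (use disc_le_1[OF assms(2) tau_nonneg] in \<open>auto simp: indicator_def\<close>)
  then show ?thesis by (simp add: emeasure_space_1)
qed

lemma laplace_id_iff:
  "laplace_id I P X \<zeta> q \<Phi> \<longleftrightarrow> (\<forall>x\<in>I. \<forall>l\<in>I. l \<le> x \<longrightarrow> K q x l = ennreal (\<Phi> x / \<Phi> l))"
proof -
  have "(\<integral>\<^sup>+\<omega>. ennreal (exp (- q * real_of_ereal (Tminus X \<zeta> l \<omega>)))
              * indicator {\<omega>. Tminus X \<zeta> l \<omega> < \<zeta> \<omega>} \<omega> \<partial>P x) = K q x l" if "x \<in> I" for x l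
    unfolding K_def
  proof (rule nn_integral_cong_AE)
    show "AE \<omega> in P x. ennreal (exp (- q * real_of_ereal (Tminus X \<zeta> l \<omega>)))
              * indicator {\<omega>. Tminus X \<zeta> l \<omega> < \<zeta> \<omega>} \<omega> = disc q (tau l \<omega>) * indicator {\<omega>. tau l \<omega> < \<zeta> \<omega>} \<omega>"
      using AE_Tminus_eq_tau[OF that, of l]
      by eventually_elim (simp add: disc_def indicator_def)
  qed
  then show ?thesis unfolding laplace_id_def by (auto cong: ball_cong)
qed

lemma K_eq_0_iff:
  assumes x: "x \<in> I"
  shows "K q x l = 0 \<longleftrightarrow> (AE \<omega> in P x. \<not> tau l \<omega> < \<zeta> \<omega>)"
proof -
  have "K q x l = 0 \<longleftrightarrow> (AE \<omega> in P x. disc q (tau l \<omega>) * indicator {\<omega>. tau l \<omega> < \<zeta> \<omega>} \<omega> = 0)"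
    unfolding K_def by (rule nn_integral_0_iff_AE[OF integrand_measurable[OF x]])
  also have "\<dots> \<longleftrightarrow> (AE \<omega> in P x. \<not> tau l \<omega> < \<zeta> \<omega>)"
    using disc_pos[of q] by (intro AE_cong) (auto simp: indicator_def less_le)
  finally show ?thesis .
qed

text \<open>The discount factor is strictly positive, so for any \<open>q\<close> the integral
  vanishes exactly when passage before the lifetime has probability zero.\<close>

lemma condP_iff:
  "condP I \<Omega> P X \<zeta> \<longleftrightarrow> (\<forall>x\<in>I. \<forall>l\<in>I. l \<le> x \<longrightarrow> 0 < K q x l)"
proof -
  have "0 < emeasure (P x) {\<omega>\<in>\<Omega>. Tminus X \<zeta> l \<omega> < \<zeta> \<omega>} \<longleftrightarrow> 0 < K q x l" if x: "x \<in> I" for x l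
  proof -
    interpret complete_measure "P x" by (rule complete_P[OF x])
    let ?A = "{\<omega>\<in>\<Omega>. Tminus X \<zeta> l \<omega> < \<zeta> \<omega>}"
    have eq: "AE \<omega> in P x. (tau l \<omega> < \<zeta> \<omega>) = (Tminus X \<zeta> l \<omega> < \<zeta> \<omega>)"
      using AE_Tminus_eq_tau[OF x, of l] by eventually_elim simp
    note [measurable] = fstop_measurable[OF tau_fstop x] fstop_measurable[OF zeta_fstop x]
    have "AE \<omega> in P x. \<omega> \<in> {\<omega>\<in>space (P x). tau l \<omega> < \<zeta> \<omega>} \<longleftrightarrow> \<omega> \<in> ?A"
      using eq AE_in_space[OF x] by eventually_elim (simp add: space_P[OF x])
    moreover have "{\<omega>\<in>space (P x). tau l \<omega> < \<zeta> \<omega>} \<in> sets (P x)" by measurable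
    \<comment> \<open>Measurability transfers from the event for \<open>tau\<close> to the almost
      surely equal event for \<open>Tminus\<close> by completeness of \<open>P x\<close>.\<close>
    ultimately have A: "?A \<in> sets (P x)" by (rule in_sets_AE) (auto simp: space_P[OF x])
    have "emeasure (P x) ?A = 0 \<longleftrightarrow> (AE \<omega> in P x. \<not> Tminus X \<zeta> l \<omega> < \<zeta> \<omega>)"
      using AE_iff_measurable[OF A, of "\<lambda>\<omega>. \<not> Tminus X \<zeta> l \<omega> < \<zeta> \<omega>"] space_P[OF x] by simp
    also have "\<dots> \<longleftrightarrow> (AE \<omega> in P x. \<not> tau l \<omega> < \<zeta> \<omega>)"
      using eq by (intro eventually_subst) (auto elim: eventually_mono)
    also have "\<dots> \<longleftrightarrow> K q x l = 0" by (rule K_eq_0_iff[OF x, symmetric])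
    finally show ?thesis by (simp add: zero_less_iff_neq_zero)
  qed
  then show ?thesis unfolding condP_def by (auto cong: ball_cong)
qed

lemma K_below:
  assumes "y \<in> I" "y \<le> b"
  shows "K q y b = 1"
proof -
  interpret prob_space "P y" using prob_P[OF assms(1)] .
  have "K q y b = (\<integral>\<^sup>+\<omega>. 1 \<partial>P y)"
    unfolding K_def
  proof (rule nn_integral_cong_AE)
    show "AE \<omega> in P y. disc q (tau b \<omega>) * indicator {\<omega>. tau b \<omega> < \<zeta> \<omega>} \<omega> = 1"
      using normality[OF assms(1)] zeta_pos[OF assms(1)]
    proof eventually_elim
      case (elim \<omega>)
      have "tau b \<omega> \<le> ereal 0"
        unfolding tau_def by (rule hit_le_of_value) (use elim assms in auto)
      then have "tau b \<omega> = 0" using tau_nonneg[of b \<omega>] by (simp add: antisym zero_ereal_def)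
      then show ?case using elim by (simp add: disc_def)
    qed
  qed
  then show ?thesis by (simp add: emeasure_space_1)
qed

lemma nn_integral_hit_functional_shift:
  assumes x: "x \<in> I" and "b < a"
  shows "(\<integral>\<^sup>+\<omega>. hit_functional q b (shift X (real_of_ereal (tau a \<omega>)) \<omega>)
      * indicator {\<omega>. tau a \<omega> < \<zeta> \<omega>} \<omega> * disc q (tau a \<omega>) \<partial>P x) = K q x b"
  unfolding K_def
proof (rule nn_integral_cong)
  fix \<omega> assume "\<omega> \<in> space (P x)"
  then have w: "\<omega> \<in> \<Omega>" using space_P[OF x] by simp
  show "hit_functional q b (shift X (real_of_ereal (tau a \<omega>)) \<omega>)
      * indicator {\<omega>. tau a \<omega> < \<zeta> \<omega>} \<omega> * disc q (tau a \<omega>)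
    = disc q (tau b \<omega>) * indicator {\<omega>. tau b \<omega> < \<zeta> \<omega>} \<omega>"
  proof (cases "tau a \<omega> < \<zeta> \<omega>")
    case True
    then show ?thesis using hit_functional_shift[OF w \<open>b < a\<close> True] by simp
  next
    case False
    moreover have "tau a \<omega> \<le> tau b \<omega>" unfolding tau_def using \<open>b < a\<close> by (intro hit_antimono) simp
    ultimately have "\<not> tau b \<omega> < \<zeta> \<omega>" by (meson le_less_trans)
    with False show ?thesis by simp
  qed
qed

lemma K_mult:
  assumes v: "cont_at_min I P X \<zeta>" and x: "x \<in> I" and m: "m \<in> I" "m \<le> x" and l: "l \<in> I" "l \<le> m"
  shows "K q x l = K q m l * K q x m"
proof (cases "l = m")
  case True
  then show ?thesis using K_below[OF m(1), of m] by simp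
next
  case False
  \<comment> \<open>Besides making \<open>hit_split\<close> available, strictness exhibits a point
    of \<open>I\<close> below \<open>m\<close>, as the definition of \<open>cont_at_min\<close>
    requires.\<close>
  then have "l < m" using l by simp
  have "AE \<omega> in P x. Tminus X \<zeta> m \<omega> < \<zeta> \<omega> \<longrightarrow> at_time X (Tminus X \<zeta> m) \<omega> = ereal m"
    using v x m l \<open>l < m\<close> unfolding cont_at_min_def by blast
  then have inner: "AE \<omega> in P x. tau m \<omega> < \<zeta> \<omega> \<longrightarrow>
      (\<integral>\<^sup>+\<omega>'. hit_functional q l (shift X 0 \<omega>') \<partial>P (real_of_ereal (at_time X (tau m) \<omega>))) = K q m l"
    using AE_Tminus_eq_tau[OF x, of m]
    by eventually_elim (auto simp: at_time_def nn_integral_hit_functional[OF m(1)])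
  note [measurable] = integrand_measurable[OF x]
  have const: "(\<integral>\<^sup>+\<omega>. K q m l * indicator {\<omega>. tau m \<omega> < \<zeta> \<omega>} \<omega> * disc q (tau m \<omega>) \<partial>P x) = K q m l * K q x m"
    unfolding K_def[of q x m]
    by (subst nn_integral_cmult[symmetric]) (auto intro!: nn_integral_cong simp: ac_simps)
  show ?thesis
  proof (rule antisym)
    show "K q x l \<le> K q m l * K q x m"
      unfolding const[symmetric] nn_integral_hit_functional_shift[OF x \<open>l < m\<close>, symmetric]
      by (rule strong_markov_discounted_le[OF tau_fstop x hit_functional_measurable])
        (use inner in \<open>auto elim: eventually_mono\<close>)
    show "K q m l * K q x m \<le> K q x l"
      unfolding const[symmetric] nn_integral_hit_functional_shift[OF x \<open>l < m\<close>, symmetric]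
      by (rule strong_markov_discounted_ge[OF tau_fstop x hit_functional_measurable])
        (use inner in \<open>auto elim: eventually_mono\<close>)
  qed
qed

text \<open>Starting above \<open>l\<close> makes the passage time strictly positive, so with
  \<open>q > 0\<close> the integrand is almost surely below 1; strictness survives integration
  against a probability measure.\<close>

lemma K_less_1:
  assumes x: "x \<in> I" and "l < x" "0 < q"
  shows "K q x l < 1"
proof -
  interpret prob_space "P x" using prob_P[OF x] .
  let ?f = "\<lambda>\<omega>. disc q (tau l \<omega>) * indicator {\<omega>. tau l \<omega> < \<zeta> \<omega>} \<omega>"
  have less: "AE \<omega> in P x. ?f \<omega> < 1"
    using normality[OF x] AE_in_space[OF x]
  proof eventually_elim
    case (elim \<omega>)
    show ?case
    proof (cases "tau l \<omega> < \<zeta> \<omega>")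
      case True
      then obtain s where s: "tau l \<omega> = ereal s" using tau_nonneg[of l \<omega>] by (cases "tau l \<omega>") auto
      have "s \<noteq> 0"
      proof
        assume "s = 0"
        then have "rinf (\<lambda>t. X t \<omega>) 0 \<le> ereal l"
          using hit_le_iff[OF path_rc[OF elim(2)], of 0 l] s by (simp add: tau_def)
        then show False using elim(1) \<open>l < x\<close> by (simp add: rinf_def)
      qed
      then have "0 < s" using s tau_nonneg[of l \<omega>] by simp
      then show ?thesis using True s \<open>0 < q\<close> by (simp add: disc_def)
    qed simp
  qed
  have "K q x l < (\<integral>\<^sup>+\<omega>. 1 \<partial>P x)"
    unfolding K_def
  proof (rule nn_integral_less[OF integrand_measurable[OF x]])
    show "(\<integral>\<^sup>+\<omega>. ?f \<omega> \<partial>P x) \<noteq> \<infinity>" using K_le_1[OF x, of q l] \<open>0 < q\<close> by (auto simp: K_def top_unique)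
    show "AE \<omega> in P x. ?f \<omega> \<le> 1" using less by eventually_elim (rule less_imp_le)
    show "\<not> (AE \<omega> in P x. 1 \<le> ?f \<omega>)"
    proof
      assume "AE \<omega> in P x. 1 \<le> ?f \<omega>"
      with less have "AE \<omega> in P x. False" by eventually_elim simp
      then show False using AE_False by simp
    qed
  qed simp
  then show ?thesis by (simp add: emeasure_space_1)
qed

text \<open>Dominated convergence along the announcing times. The delicate paths are those without
  passage before the lifetime, where the integrands must tend to 0.\<close>

lemma K_tendsto:
  assumes x: "x \<in> I" and q: "0 < q"
  shows "(\<lambda>n. K q x (l + 1 / real (Suc n))) \<longlonglongrightarrow> K q x l"
  unfolding K_def
proof (rule nn_integral_dominated_convergence[where w = "\<lambda>_. 1"])
  interpret prob_space "P x" using prob_P[OF x] .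
  show "(\<integral>\<^sup>+\<omega>. 1 \<partial>P x) < \<infinity>" by (simp add: emeasure_space_1)
  show "AE \<omega> in P x. disc q (tau (l + 1 / real (Suc n)) \<omega>) *
      indicator {\<omega>. tau (l + 1 / real (Suc n)) \<omega> < \<zeta> \<omega>} \<omega> \<le> 1" for n
    by (rule AE_I2) (use disc_le_1[OF less_imp_le[OF q] tau_nonneg] in \<open>auto simp: indicator_def\<close>)
  let ?T = "\<lambda>n. tau (l + 1 / real (Suc n))"
  show "AE \<omega> in P x. (\<lambda>n. disc q (?T n \<omega>) * indicator {\<omega>. ?T n \<omega> < \<zeta> \<omega>} \<omega>)
     \<longlonglongrightarrow> disc q (tau l \<omega>) * indicator {\<omega>. tau l \<omega> < \<zeta> \<omega>} \<omega>"
    using AE_Tminus_eq_tau[OF x, of l] AE_in_space[OF x]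
  proof eventually_elim
    case (elim \<omega>)
    have inc: "incseq (\<lambda>n. ?T n \<omega>)" and lim: "(\<lambda>n. ?T n \<omega>) \<longlonglongrightarrow> tau l \<omega>"
      using hit_tendsto[OF path_rc[OF elim(2)], of l] by (simp_all add: tau_def)
    show ?case
    proof (cases "tau l \<omega> < \<zeta> \<omega>")
      case True
      have "?T n \<omega> < \<zeta> \<omega>" for n
        using incseq_le[OF inc lim, of n] True by (rule le_less_trans)
      moreover obtain s where s: "tau l \<omega> = ereal s" using True tau_nonneg[of l \<omega>] by (cases "tau l \<omega>") auto
      then have "(\<lambda>n. real_of_ereal (?T n \<omega>)) \<longlonglongrightarrow> real_of_ereal (tau l \<omega>)"
        using lim_real_of_ereal[of "\<lambda>n. ?T n \<omega>" s] lim by simp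
      then have "(\<lambda>n. disc q (?T n \<omega>)) \<longlonglongrightarrow> disc q (tau l \<omega>)"
        unfolding disc_def by (intro tendsto_ennrealI tendsto_exp tendsto_mult_left)
      ultimately show ?thesis using True by simp
    next
      case False
      have "(\<lambda>n. disc q (?T n \<omega>) * indicator {\<omega>. ?T n \<omega> < \<zeta> \<omega>} \<omega>) \<longlonglongrightarrow> 0"
      proof (cases "\<forall>n. ?T n \<omega> < \<zeta> \<omega>")
        case True
        \<comment> \<open>If all approximating passages precede the lifetime but the limit does not,
          the limit is infinite, since \<open>Tminus\<close> is infinite unless it lies below the
          lifetime. The discount with \<open>q > 0\<close> then tends to 0.\<close>
        have "tau l \<omega> = \<infinity>" using Tminus_infinite[of l \<omega>] elim(1) False by metis
        then have top: "(\<lambda>n. ?T n \<omega>) \<longlonglongrightarrow> \<infinity>" using lim by simp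
        have fin: "?T n \<omega> = ereal (real_of_ereal (?T n \<omega>))" for n
          using True[rule_format, of n] tau_nonneg[of "l + 1 / real (Suc n)" \<omega>] by (cases "?T n \<omega>") auto
        have "filterlim (\<lambda>n. real_of_ereal (?T n \<omega>)) at_top sequentially"
          using top fin by (subst (asm) fin) (simp add: tendsto_PInfty_eq_at_top)
        then have "filterlim (\<lambda>n. q * real_of_ereal (?T n \<omega>)) at_top sequentially"
          using q by (intro filterlim_tendsto_pos_mult_at_top[OF tendsto_const])
        then have "(\<lambda>n. exp (- (q * real_of_ereal (?T n \<omega>)))) \<longlonglongrightarrow> 0"
          by (intro filterlim_compose[OF exp_at_bot] filterlim_compose[OF filterlim_uminus_at_bot_at_top])
        then have "(\<lambda>n. disc q (?T n \<omega>)) \<longlonglongrightarrow> ennreal 0"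
          unfolding disc_def by (intro tendsto_ennrealI) simp
        then show ?thesis using True by simp
      next
        case False
        then obtain N where N: "\<zeta> \<omega> \<le> ?T N \<omega>" by (auto simp: not_less)
        have "\<forall>\<^sub>F n in sequentially. disc q (?T n \<omega>) * indicator {\<omega>. ?T n \<omega> < \<zeta> \<omega>} \<omega> = 0"
          using eventually_ge_at_top[of N]
        proof eventually_elim
          case (elim n)
          have "\<zeta> \<omega> \<le> ?T n \<omega>" using N incseqD[OF inc elim] by (rule order_trans)
          then show ?case by (simp add: not_less[symmetric])
        qed
        then show ?thesis by (rule tendsto_eventually)
      qed
      then show ?thesis using False by simp
    qed
  qed
qed (use integrand_measurable[OF x] in auto)

lemma I_upward_closed: "x \<in> I \<Longrightarrow> x \<le> y \<Longrightarrow> y \<in> I"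
  using I_unbounded interval_I by (meson less_imp_le mem_is_interval_1_I)

lemma laplace_exists:
  assumes v: "cont_at_min I P X \<zeta>" and p: "condP I \<Omega> P X \<zeta>" and q: "0 \<le> q"
  shows "\<exists>\<Phi> :: real \<Rightarrow> real.
              (\<forall>x\<in>I. 0 < \<Phi> x) \<and>
              (\<forall>x\<in>I. \<forall>y\<in>I. x \<le> y \<longrightarrow> \<Phi> y \<le> \<Phi> x) \<and>
              (0 < q \<longrightarrow> (\<forall>x\<in>I. \<forall>y\<in>I. x < y \<longrightarrow> \<Phi> y < \<Phi> x) \<and>
                         (\<forall>x\<in>I. (\<Phi> \<longlongrightarrow> \<Phi> x) (at x within I \<inter> {x<..}))) \<and>
              laplace_id I P X \<zeta> q \<Phi>"
proof -
  define k where "k x l = enn2real (K q x l)" for x l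
  have Kk: "K q x l = ennreal (k x l)" if "x \<in> I" for x l
    using K_le_1[OF that q, of l] 
    unfolding k_def by (intro ennreal_enn2real[symmetric]) (auto intro: le_less_trans)
  have k_nonneg: "0 \<le> k x l" for x l by (simp add: k_def)
  have k_pos: "0 < k x l" if "x \<in> I" "l \<in> I" "l \<le> x" for x l
  proof -
    have "0 < K q x l" using p that unfolding condP_iff[of q] by blast
    then show ?thesis by (simp add: Kk[OF that(1)])
  qed
  have k_le: "k x l \<le> 1" if "x \<in> I" for x l
    using K_le_1[OF that q, of l] Kk[OF that, of l] by simp
  have k_less: "k x l < 1" if "x \<in> I" "l < x" "0 < q" for x l
    using K_less_1[OF that] Kk[OF that(1), of l] by (simp add: ennreal_less_iff k_nonneg flip: ennreal_1)
  have k_self: "k x x = 1" if "x \<in> I" for x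
    using K_below[OF that order_refl, of q] by (simp add: k_def)
  have k_mult: "k x l = k m l * k x m" if "x \<in> I" "m \<in> I" "m \<le> x" "l \<in> I" "l \<le> m" for x m l
    unfolding k_def K_mult[OF v that] by (rule enn2real_mult)
  obtain c where c: "c \<in> I" using I_nonempty by blast
  \<comment> \<open>Only ratios of \<open>\<Phi>\<close> are prescribed, so \<open>c\<close> serves
    as the base point with \<open>\<Phi> c = 1\<close>; below it the ratio is read in the other
    direction.\<close>
  define \<Phi> where "\<Phi> x = (if c \<le> x then k x c else 1 / k c x)" for x
  have pos: "0 < \<Phi> x" if "x \<in> I" for x
    using k_pos that c by (auto simp: \<Phi>_def)
  have ratio: "\<Phi> x = k x l * \<Phi> l" if "x \<in> I" "l \<in> I" "l \<le> x" for x l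
  proof -
    consider "c \<le> l" | "l < c" "c \<le> x" | "x < c" by linarith
    then show ?thesis
    proof cases
      case 1
      then show ?thesis using k_mult[OF that(1,2,3) c] that by (simp add: \<Phi>_def)
    next
      case 2
      then have "k x l = k c l * k x c" using k_mult[of x c l] that c by simp
      then show ?thesis using 2 k_pos[of c l] that c by (simp add: \<Phi>_def)
    next
      case 3
      then have "k c l = k x l * k c x" using k_mult[of c x l] that c by simp
      then show ?thesis using 3 k_pos[of x l] k_pos[of c x] that c by (simp add: \<Phi>_def field_simps)
    qed
  qed
  have mono: "\<Phi> y \<le> \<Phi> x" if "x \<in> I" "y \<in> I" "x \<le> y" for x y
    using ratio[OF that(2,1,3)] k_le[OF that(2), of x] pos[OF that(1)] by (simp add: mult_le_cancel_right1)
  have strict: "\<Phi> y < \<Phi> x" if "x \<in> I" "y \<in> I" "x < y" "0 < q" for x y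
    using ratio[OF that(2,1)] k_less[OF that(2,3,4)] pos[OF that(1)] that(3) by simp
  have rcont: "(\<Phi> \<longlongrightarrow> \<Phi> x) (at x within I \<inter> {x<..})" if x: "x \<in> I" and q0: "0 < q" for x
  proof -
    let ?y = "\<lambda>n. x + 1 / real (Suc n)"
    have y: "?y n \<in> I" "?y n \<le> x + 1" for n using I_upward_closed[OF x, of "?y n"] by auto
    \<comment> \<open>\<open>K_tendsto\<close> lets the level vary with the starting point fixed,
      whereas \<open>\<Phi> (?y n)\<close> involves varying starting points. Multiplicativity
      rewrites the latter as quotients with the common starting point \<open>x + 1\<close>.\<close>
    have z: "x + 1 \<in> I" using I_upward_closed[OF x, of "x + 1"] by simp
    have "(\<lambda>n. k (x + 1) (?y n)) \<longlonglongrightarrow> k (x + 1) x"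
    proof -
      have "(\<lambda>n. ennreal (k (x + 1) (?y n))) \<longlonglongrightarrow> ennreal (k (x + 1) x)"
        using K_tendsto[OF z q0, of x] by (simp only: Kk[OF z])
      then show ?thesis by (subst (asm) tendsto_ennreal_iff) (auto simp: k_nonneg)
    qed
    then have "(\<lambda>n. k (x + 1) x / k (x + 1) (?y n) * \<Phi> x) \<longlonglongrightarrow> k (x + 1) x / k (x + 1) x * \<Phi> x"
      using k_pos[OF z x] by (intro tendsto_intros) auto
    moreover have "k (x + 1) x / k (x + 1) (?y n) * \<Phi> x = \<Phi> (?y n)" for n
    proof -
      have "k (x + 1) x = k (?y n) x * k (x + 1) (?y n)"
        using k_mult[OF z y x, of n] by simp
      then show ?thesis
        using ratio[OF y(1)[of n] x] k_pos[OF z y, of n] by simp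
    qed
    ultimately have lim: "(\<lambda>n. \<Phi> (?y n)) \<longlonglongrightarrow> \<Phi> x" using k_pos[OF z x] by simp
    \<comment> \<open>Monotonicity upgrades the limit along one sequence to the full limit from the
      right.\<close>
    show ?thesis
    proof (rule order_tendstoI)
      fix d assume "d < \<Phi> x"
      then obtain n where n: "d < \<Phi> (?y n)"
        using eventually_happens[OF order_tendstoD(1)[OF lim]] by auto
      show "\<forall>\<^sub>F u in at x within I \<inter> {x<..}. d < \<Phi> u"
        unfolding eventually_at
      proof (intro exI[of _ "1 / real (Suc n)"] conjI ballI impI)
        fix u assume u: "u \<in> I \<inter> {x<..}" "u \<noteq> x \<and> dist u x < 1 / real (Suc n)"
        then have "\<Phi> (?y n) \<le> \<Phi> u" using y(1)[of n] by (intro mono) (auto simp: dist_real_def)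
        with n show "d < \<Phi> u" by simp
      qed simp
    next
      fix d assume d: "\<Phi> x < d"
      show "\<forall>\<^sub>F u in at x within I \<inter> {x<..}. \<Phi> u < d"
        unfolding eventually_at
      proof (intro exI[of _ 1] conjI ballI impI)
        fix u assume "u \<in> I \<inter> {x<..}"
        then have "\<Phi> u \<le> \<Phi> x" using x by (intro mono) auto
        with d show "\<Phi> u < d" by simp
      qed simp
    qed
  qed
  have "laplace_id I P X \<zeta> q \<Phi>"
    unfolding laplace_id_iff
  proof (intro ballI impI)
    fix x l assume xl: "x \<in> I" "l \<in> I" "l \<le> x"
    then have "\<Phi> x / \<Phi> l = k x l" using ratio[OF xl] pos[OF xl(2)] by simp
    then show "K q x l = ennreal (\<Phi> x / \<Phi> l)" using Kk[OF xl(1)] by simp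
  qed
  then show ?thesis using pos mono strict rcont by (intro exI[of _ \<Phi>]) blast
qed

lemma laplace_imp_cont_at_min:
  assumes q: "0 < q" and pos: "\<And>x. x \<in> I \<Longrightarrow> 0 < \<Phi> x"
    and dec: "\<And>x y. x \<in> I \<Longrightarrow> y \<in> I \<Longrightarrow> x < y \<Longrightarrow> \<Phi> y < \<Phi> x"
    and lap: "laplace_id I P X \<zeta> q \<Phi>"
  shows "cont_at_min I P X \<zeta>" and "condP I \<Omega> P X \<zeta>"
proof -
  have K: "K q x l = ennreal (\<Phi> x / \<Phi> l)" if "x \<in> I" "l \<in> I" "l \<le> x" for x l
    using lap that unfolding laplace_id_iff by blast
  show "condP I \<Omega> P X \<zeta>" unfolding condP_iff[of q] using K pos by simp
  have no_overshoot: "AE \<omega> in P x. \<not> (tau a \<omega> = tau b \<omega> \<and> tau a \<omega> < \<zeta> \<omega>)"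
    if x: "x \<in> I" and a: "a \<in> I" "a \<le> x" and b: "b \<in> I" "b < a" for x a b
  proof -
    note [measurable] = fstop_measurable[OF tau_fstop x] alive_indicator_measurable[OF tau_fstop x]
    define c where "c = \<Phi> a / \<Phi> b"
    have c: "0 < c" "c < 1" using pos a b dec[OF b(1) a(1) b(2)] by (auto simp: c_def)
    \<comment> \<open>A measurable lower bound for the law after \<open>tau a\<close>: it is 1 when
      the path overshoots \<open>b\<close>, and \<open>c\<close> otherwise, because a landing point
      in \<open>(b,a]\<close> has \<open>\<Phi>\<close> at least \<open>\<Phi> a\<close>.\<close>
    define u where "u \<omega> = ennreal c + ennreal (1 - c) * indicator {\<omega>. tau a \<omega> = tau b \<omega>} \<omega>" for \<omega>
    define g where "g \<omega> = indicator {\<omega>. tau a \<omega> < \<zeta> \<omega>} \<omega> * disc q (tau a \<omega>)" for \<omega>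
    have ind [measurable]: "(\<lambda>\<omega>. indicator {\<omega>. tau a \<omega> = tau b \<omega>} \<omega> :: ennreal) \<in> borel_measurable (P x)"
    proof -
      have "(\<lambda>\<omega>. if tau a \<omega> = tau b \<omega> then 1 else 0 :: ennreal) \<in> borel_measurable (P x)" by measurable
      also have "(\<lambda>\<omega>. if tau a \<omega> = tau b \<omega> then 1 else 0 :: ennreal)
        = (\<lambda>\<omega>. indicator {\<omega>. tau a \<omega> = tau b \<omega>} \<omega>)" by (auto simp: fun_eq_iff)
      finally show ?thesis .
    qed
    have [measurable]: "u \<in> borel_measurable (P x)" unfolding u_def[abs_def] by measurable
    have [measurable]: "g \<in> borel_measurable (P x)" unfolding g_def[abs_def] by measurable
    have one: "ennreal c + ennreal (1 - c) = 1" using c by (simp flip: ennreal_plus)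
    have "AE \<omega> in P x. tau a \<omega> < \<zeta> \<omega> \<longrightarrow>
      u \<omega> \<le> (\<integral>\<^sup>+\<omega>'. hit_functional q b (shift X 0 \<omega>') \<partial>P (real_of_ereal (at_time X (tau a) \<omega>)))"
      using AE_Tminus_eq_tau[OF x, of a] AE_in_space[OF x]
    proof eventually_elim
      case (elim \<omega>)
      show ?case
      proof
        assume lt: "tau a \<omega> < \<zeta> \<omega>"
        then obtain s where s: "tau a \<omega> = ereal s" using tau_nonneg[of a \<omega>] by (cases "tau a \<omega>") auto
        have "0 \<le> s" using tau_nonneg[of a \<omega>] s by simp
        then obtain y where y: "y \<in> I" "X s \<omega> = ereal y" using cadlag(1)[OF elim(2), of s] lt s by auto
        have "y \<le> a" using elim(1) lt s y by (simp add: at_time_def)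
        have "u \<omega> \<le> K q y b"
        proof (cases "y \<le> b")
          case True
          then show ?thesis using K_below[OF y(1) True, of q] one c by (auto simp: u_def indicator_def)
        next
          case False
          have "tau a \<omega> \<noteq> tau b \<omega>"
          proof
            assume "tau a \<omega> = tau b \<omega>"
            then have "X s \<omega> \<le> ereal b"
              using hit_eq_value_le[OF path_rc[OF elim(2)] b(2), of s] s by (simp add: tau_def)
            then show False using False y by simp
          qed
          then have "u \<omega> = ennreal c" by (simp add: u_def)
          also have "\<dots> \<le> ennreal (\<Phi> y / \<Phi> b)"
          proof -
            have "\<Phi> a \<le> \<Phi> y" using dec[OF y(1) a(1)] \<open>y \<le> a\<close> by (cases "y = a") auto
            then show ?thesis using pos[OF b(1)] by (auto simp: c_def intro!: ennreal_leI divide_right_mono)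
          qed
          also have "\<dots> = K q y b" using K[OF y(1) b(1)] False by simp
          finally show ?thesis .
        qed
        then show "u \<omega> \<le> (\<integral>\<^sup>+\<omega>'. hit_functional q b (shift X 0 \<omega>') \<partial>P (real_of_ereal (at_time X (tau a) \<omega>)))"
          using y s by (simp add: nn_integral_hit_functional at_time_def)
      qed
    qed
    from strong_markov_discounted_ge[OF tau_fstop x hit_functional_measurable _ this, of q]
    have "(\<integral>\<^sup>+\<omega>. u \<omega> * g \<omega> \<partial>P x) \<le> K q x b"
      unfolding nn_integral_hit_functional_shift[OF x b(2)] by (simp add: g_def mult.assoc)
    also have "(\<integral>\<^sup>+\<omega>. u \<omega> * g \<omega> \<partial>P x)
      = (\<integral>\<^sup>+\<omega>. ennreal c * g \<omega> + ennreal (1 - c) * (indicator {\<omega>. tau a \<omega> = tau b \<omega>} \<omega> * g \<omega>) \<partial>P x)"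
      by (intro nn_integral_cong) (simp add: u_def distrib_right mult.assoc)
    also have "\<dots> = ennreal c * (\<integral>\<^sup>+\<omega>. g \<omega> \<partial>P x)
        + ennreal (1 - c) * (\<integral>\<^sup>+\<omega>. indicator {\<omega>. tau a \<omega> = tau b \<omega>} \<omega> * g \<omega> \<partial>P x)"
      by (simp add: nn_integral_add nn_integral_cmult)
    \<comment> \<open>The identity (S) makes this term alone equal to the finite upper bound
      \<open>K q x b\<close>, so nothing is left for the overshoot term.\<close>
    also have "ennreal c * (\<integral>\<^sup>+\<omega>. g \<omega> \<partial>P x) = K q x b"
    proof -
      have "(\<integral>\<^sup>+\<omega>. g \<omega> \<partial>P x) = K q x a" unfolding K_def g_def by (simp add: mult.commute)
      then show ?thesis
        using K[OF x a] K[OF x b(1)] a b pos[OF a(1)] pos[OF b(1)] pos[OF x] c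
        by (simp add: c_def flip: ennreal_mult)
    qed
    finally have "ennreal (1 - c) * (\<integral>\<^sup>+\<omega>. indicator {\<omega>. tau a \<omega> = tau b \<omega>} \<omega> * g \<omega> \<partial>P x) = 0"
      using K[OF x b(1)] a b ennreal_add_left_cancel_le[of "K q x b" _ 0] by simp
    then have "(\<integral>\<^sup>+\<omega>. indicator {\<omega>. tau a \<omega> = tau b \<omega>} \<omega> * g \<omega> \<partial>P x) = 0"
      using c by simp
    then have "AE \<omega> in P x. indicator {\<omega>. tau a \<omega> = tau b \<omega>} \<omega> * g \<omega> = 0"
      by (subst (asm) nn_integral_0_iff_AE) auto
    then show ?thesis
    proof eventually_elim
      case (elim \<omega>)
      then show ?case using disc_pos[of q "tau a \<omega>"] by (auto simp: g_def indicator_def less_le)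
    qed
  qed
  show "cont_at_min I P X \<zeta>"
    unfolding cont_at_min_def
  proof (intro ballI impI)
    fix x a assume x: "x \<in> I" and a: "a \<in> I" "a \<le> x \<and> (\<exists>b\<in>I. b < a)"
    then obtain b where b: "b \<in> I" "b < a" by blast
    \<comment> \<open>Levels in \<open>I\<close> that start at \<open>b\<close> and increase to
      \<open>a\<close>: any landing point strictly below \<open>a\<close> lies below one of
      them.\<close>
    define b' where "b' n = a - (a - b) / real (Suc n)" for n
    have b': "b' n \<in> I" "b' n < a" for n
    proof -
      have "(a - b) / real (Suc n) \<le> a - b" 
        using b mult_right_mono[of b a "real n"] by (simp add: field_simps)
      then show "b' n \<in> I" by (intro I_upward_closed[OF b(1)]) (simp add: b'_def)
      show "b' n < a" using b by (simp add: b'_def)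
    qed
    have "b' \<longlonglongrightarrow> a - (a - b) * 0"
      unfolding b'_def divide_inverse
      by (intro tendsto_intros LIMSEQ_inverse_real_of_nat)
    then have lim: "b' \<longlonglongrightarrow> a" by simp
    have "AE \<omega> in P x. \<forall>n. \<not> (tau a \<omega> = tau (b' n) \<omega> \<and> tau a \<omega> < \<zeta> \<omega>)"
      unfolding AE_all_countable using no_overshoot[OF x a(1) _ b'] a by blast
    then show "AE \<omega> in P x. Tminus X \<zeta> a \<omega> < \<zeta> \<omega> \<longrightarrow> at_time X (Tminus X \<zeta> a) \<omega> = ereal a"
      using AE_Tminus_eq_tau[OF x, of a] AE_in_space[OF x]
    proof eventually_elim
      case (elim \<omega>)
      show ?case
      proof (intro impI, rule ccontr)
        assume lt: "Tminus X \<zeta> a \<omega> < \<zeta> \<omega>" and ne: "at_time X (Tminus X \<zeta> a) \<omega> \<noteq> ereal a"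
        have lt': "tau a \<omega> < \<zeta> \<omega>" using lt elim(2) by simp
        then obtain s where s: "tau a \<omega> = ereal s" using tau_nonneg[of a \<omega>] by (cases "tau a \<omega>") auto
        have s0: "0 \<le> s" using tau_nonneg[of a \<omega>] s by simp
        then obtain y where y: "y \<in> I" "X s \<omega> = ereal y" using cadlag(1)[OF elim(3), of s] lt' s by auto
        have "y < a" using elim(2) lt' s y ne by (auto simp: at_time_def)
        then obtain n where "y < b' n"
          using eventually_happens[OF order_tendstoD(1)[OF lim]] by auto
        then have "tau (b' n) \<omega> \<le> tau a \<omega>"
          unfolding s unfolding tau_def by (intro hit_le_of_value s0) (use y in auto)
        moreover have "tau a \<omega> \<le> tau (b' n) \<omega>"
          unfolding tau_def using b'(2)[of n] by (intro hit_antimono) simp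
        ultimately show False using elim(1) lt' by (metis antisym)
      qed
    qed
  qed
qed

end

theorem mainTheorem1:
  fixes I :: "real set" and \<Omega> :: "'a set" and F :: "real \<Rightarrow> 'a set set"
    and P :: "real \<Rightarrow> 'a measure" and X :: "real \<Rightarrow> 'a \<Rightarrow> ereal" and \<zeta> :: "'a \<Rightarrow> ereal"
  assumes setting: "standing_setting I \<Omega> F P X \<zeta>"
  defines "i \<equiv> no_neg_jumps I P X \<zeta> \<and> condP I \<Omega> P X \<zeta>"
    and "ii \<equiv> run_inf_continuous I P X \<zeta> \<and> condP I \<Omega> P X \<zeta>"
    and "iii \<equiv> (\<forall>q\<ge>0. \<exists>\<Phi> :: real \<Rightarrow> real.
              (\<forall>x\<in>I. 0 < \<Phi> x) \<and>
              (\<forall>x\<in>I. \<forall>y\<in>I. x \<le> y \<longrightarrow> \<Phi> y \<le> \<Phi> x) \<and>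
              (0 < q \<longrightarrow> (\<forall>x\<in>I. \<forall>y\<in>I. x < y \<longrightarrow> \<Phi> y < \<Phi> x) \<and>
                         (\<forall>x\<in>I. (\<Phi> \<longlongrightarrow> \<Phi> x) (at x within I \<inter> {x<..}))) \<and>
              laplace_id I P X \<zeta> q \<Phi>)"
    and "iv \<equiv> (\<exists>q>0. \<exists>\<Phi> :: real \<Rightarrow> real.
              (\<forall>x\<in>I. 0 < \<Phi> x) \<and>
              (\<forall>x\<in>I. \<forall>y\<in>I. x < y \<longrightarrow> \<Phi> y < \<Phi> x) \<and>
              laplace_id I P X \<zeta> q \<Phi>)"
    and "v \<equiv> cont_at_min I P X \<zeta> \<and> condP I \<Omega> P X \<zeta>"
  shows "(i \<longleftrightarrow> ii) \<and> (ii \<longleftrightarrow> iii) \<and> (iii \<longleftrightarrow> iv) \<and> (iv \<longleftrightarrow> v) \<and>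
         (no_neg_jumps I P X \<zeta> \<longleftrightarrow> run_inf_continuous I P X \<zeta>) \<and>
         (run_inf_continuous I P X \<zeta> \<longleftrightarrow> cont_at_min I P X \<zeta>)"
proof -
  interpret markov_setting I \<Omega> F P X \<zeta> by unfold_locales (rule setting)
  \<comment> \<open>The three implications form a cycle among the properties alone; adding
    \<open>condP\<close> to each of them then gives the equivalence of (i), (ii) and (v).\<close>
  have jr: "no_neg_jumps I P X \<zeta> \<longleftrightarrow> run_inf_continuous I P X \<zeta>"
    and rm: "run_inf_continuous I P X \<zeta> \<longleftrightarrow> cont_at_min I P X \<zeta>"
    using no_neg_jumps_imp_run_inf_continuous run_inf_continuous_imp_cont_at_min
      cont_at_min_imp_no_neg_jumps by blast+
  have "v \<Longrightarrow> iii" unfolding v_def iii_def using laplace_exists by blast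
  moreover have "iii \<Longrightarrow> iv"
  proof -
    assume iii
    then obtain \<Phi> :: "real \<Rightarrow> real" where "\<forall>x\<in>I. 0 < \<Phi> x" "\<forall>x\<in>I. \<forall>y\<in>I. x < y \<longrightarrow> \<Phi> y < \<Phi> x"
      "laplace_id I P X \<zeta> 1 \<Phi>"
      unfolding iii_def by (metis zero_le_one zero_less_one)
    then show iv unfolding iv_def by (intro exI[of _ 1]) auto
  qed
  moreover have "iv \<Longrightarrow> v"
    unfolding iv_def v_def by (elim exE conjE) (intro conjI laplace_imp_cont_at_min; blast)
  moreover have "i \<longleftrightarrow> ii" "ii \<longleftrightarrow> v" unfolding i_def ii_def v_def using jr rm by blast+
  ultimately show ?thesis using jr rm by blast
qed

end
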